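(* Let $r_\lambda$ be a real resonance point of a line $\{H_r=H_0+rV:r\in\mathbb R\}$ regular at an essentially regular point $\lambda$. For either choice of the sign, if a resonance vector $u^{(k)}\in\Upsilon_{\lambda\pm i0}(r_\lambda)$ has order $k$, then the vectors $$u^{(1)},\ldots,u^{(\lceil k/2\rceil)}$$ are of type I, where $\lceil k/2\rceil$ is the smallest integer not less than $k/2$ and $u^{(j)}=\mathbf A^{k-j}_{\lambda\pm i0}(r_\lambda)u^{(k)}$.
   Context: Setting. $\mathcal H,\mathcal K$ are complex separable Hilbert spaces. $F:\mathcal H\to\mathcal K$ is a closed densely defined operator with trivial kernel and co-kernel. $\{H_r=H_0+rV:r\in\mathbb R\}$ is a line of self-adjoint operators on $\mathcal H$, $V=F^*JF$ self-adjoint with $J$ bounded self-adjoint on $\mathcal K$. Standing assumptions: all $H_r$ have a common dense domain $\mathcal D$, $\mathcal D\subset\operatorname{dom}(F)\cap\operatorname{dom}(V)$, $V$ is relatively compact with respect to each $H_r$, and for non-real $z$ the operator $T_z(H_r):=F(H_r-z)^{-1}F^*$ (densely defined on $\operatorname{dom}F^*$) extends to a compact operator on $\mathcal K$, also denoted $T_z(H_r)$. $\Lambda(H_r,F)$ is the set of real $\lambda$ for which the norm limits $T_{\lambda\pm i0}(H_r):=\lim_{y\to0^+}T_{\lambda\pm iy}(H_r)$ exist (assumed of full Lebesgue measure). It is assumed that $\lambda\in\Lambda(H_r,F)$ for some real $r$ (that is, the line is regular at $\lambda$); a real $r$ is non-resonant if $\lambda\in\Lambda(H_r,F)$, otherwise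 it is a real resonance point. $\operatorname{Im}T=(T-T^* )/(2i)$. For $z=\lambda\pm i0$ and non-resonant $s$ put $A_z(s)=T_z(H_s)J$; as a function of $s$ it extends meromorphically to $\mathbb C$, its real poles being the real resonance points. For such a pole $r_\lambda$: $\Upsilon^k_z(r_\lambda)=\{u\in\mathcal K:(1+(r_\lambda-s)A_z(s))^ku=0\}$ (independent of the non-resonant real $s$), $\Upsilon_z(r_\lambda)=\bigcup_k\Upsilon_z^k(r_\lambda)$; a resonance vector has order $k$ if it is in $\Upsilon^k_z(r_\lambda)$ but not in $\Upsilon^{k-1}_z(r_\lambda)$. $\mathbf A_z(r_\lambda)=\frac1{2\pi i}\oint_{C(r_\lambda)}(s-r_\lambda)A_z(s)\,ds$, where $C(r_\lambda)$ is a small counter-clockwise circle around $r_\lambda$ enclosing no other poles; $\mathbf A^j_z(r_\lambda)$ is its $j$-th power ($\mathbf A^0_z(r_\lambda)$ acts as the identity on $\Upsilon_z(r_\lambda)$). A vector $u\in\Upsilon_{\lambda\pm i0}(r_\lambda)$ is of type I if $\sqrt{\operatorname{Im}T_{\lambda+i0}(H_s)}\,Ju=0$ for every non-resonant real $s$. *)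

theory Defs
  imports "HOL-Complex_Analysis.Complex_Analysis"
begin

section \<open>Complex Hilbert spaces\<close>

class complex_normed_space = real_normed_vector +
  fixes scaleC :: "complex \<Rightarrow> 'a \<Rightarrow> 'a"  (infixr "*\<^sub>C" 75)
  assumes scaleC_add_right: "c *\<^sub>C (x + y) = c *\<^sub>C x + c *\<^sub>C y"
    and scaleC_add_left: "(c + d) *\<^sub>C x = c *\<^sub>C x + d *\<^sub>C x"
    and scaleC_scaleC: "c *\<^sub>C d *\<^sub>C x = (c * d) *\<^sub>C x"
    and scaleC_of_real: "of_real r *\<^sub>C x = r *\<^sub>R x"
    and norm_scaleC: "norm (c *\<^sub>C x) = cmod c * norm x"

text \<open>The inner product is conjugate-linear in its first argument.  Positive definiteness and
  the relation to the norm are inherited from \<open>real_inner\<close>, because the real inner product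
  is required to be the real part of the complex one.\<close>

class complex_hilbert = real_inner + banach + complex_normed_space +
  fixes cinner :: "'a \<Rightarrow> 'a \<Rightarrow> complex"
  assumes cinner_commute: "cinner x y = cnj (cinner y x)"
    and cinner_add_right: "cinner x (y + z) = cinner x y + cinner x z"
    and cinner_scaleC_right: "cinner x (c *\<^sub>C y) = c * cinner x y"
    and Re_cinner: "Re (cinner x y) = inner x y"

text \<open>Bounded operators are elements of the library type of bounded real-linear maps (whose norm
  is the operator norm); complex linearity is imposed separately where it is needed.\<close>

instantiation blinfun :: (real_normed_vector, complex_normed_space) complex_normed_space
begin

lift_definition scaleC_blinfun ::
  "complex \<Rightarrow> 'a \<Rightarrow>\<^sub>L 'b \<Rightarrow> 'a \<Rightarrow>\<^sub>L 'b"
  is "\<lambda>c f x. c *\<^sub>C f x"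
proof -
  fix c :: complex and f :: "'a \<Rightarrow> 'b"
  assume "bounded_linear f"
  then interpret f: bounded_linear f .
  obtain K where K: "\<And>x. norm (f x) \<le> norm x * K"
    using f.bounded by blast
  show "bounded_linear (\<lambda>x. c *\<^sub>C f x)"
  proof (rule bounded_linear_intro[where K = "cmod c * K"])
    fix x y r
    show "c *\<^sub>C f (x + y) = c *\<^sub>C f x + c *\<^sub>C f y"
      by (simp add: f.add scaleC_add_right)
    show "c *\<^sub>C f (r *\<^sub>R x) = r *\<^sub>R c *\<^sub>C f x"
      by (simp add: f.scaleR scaleC_scaleC mult.commute flip: scaleC_of_real)
    show "norm (c *\<^sub>C f x) \<le> norm x * (cmod c * K)"
      using mult_left_mono[OF K[of x] norm_ge_zero[of c]]
      by (simp add: norm_scaleC mult_ac)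
  qed
qed

instance
proof
  fix c d :: complex and x y :: "'a \<Rightarrow>\<^sub>L 'b" and r :: real
  show "c *\<^sub>C (x + y) = c *\<^sub>C x + c *\<^sub>C y"
    by transfer (simp add: scaleC_add_right)
  show "(c + d) *\<^sub>C x = c *\<^sub>C x + d *\<^sub>C x"
    by transfer (simp add: scaleC_add_left)
  show "c *\<^sub>C d *\<^sub>C x = (c * d) *\<^sub>C x"
    by transfer (simp add: scaleC_scaleC)
  show "of_real r *\<^sub>C x = r *\<^sub>R x"
    by transfer (simp add: scaleC_of_real)
  have le: "norm (c *\<^sub>C x) \<le> cmod c * norm x" for c and x :: "'a \<Rightarrow>\<^sub>L 'b"
  proof (rule norm_blinfun_bound)
    show "norm (blinfun_apply (c *\<^sub>C x) v) \<le> cmod c * norm x * norm v" for v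
      using mult_left_mono[OF norm_blinfun[of x v] norm_ge_zero[of c]]
      by (simp add: scaleC_blinfun.rep_eq norm_scaleC mult_ac)
  qed simp
  show "norm (c *\<^sub>C x) = cmod c * norm x"
  proof (cases "c = 0")
    case True
    then show ?thesis using le[of c x] by simp
  next
    case False
    have one: "1 *\<^sub>C v = v" for v :: 'b
      using scaleC_of_real[of 1 v] by simp
    have "inverse c *\<^sub>C c *\<^sub>C x = x"
      using False by transfer (simp add: scaleC_scaleC one)
    with le[of "inverse c" "c *\<^sub>C x"]
    have "norm x \<le> norm (c *\<^sub>C x) / cmod c"
      by (simp only: norm_inverse divide_inverse mult.commute)
    with False have "cmod c * norm x \<le> norm (c *\<^sub>C x)"
      by (simp only: pos_le_divide_eq zero_less_norm_iff mult.commute not_False_eq_True)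
    with le[of c x] show ?thesis by simp
  qed
qed

end

section \<open>Unbounded operators, as graphs\<close>

text \<open>A (possibly unbounded, partially defined) operator is identified with its graph.  Its domain
  is \<open>Domain\<close>, the product \<open>S T\<close> (first \<open>T\<close>, then \<open>S\<close>, on its
  natural domain) is the relational composition \<open>T O S\<close>, and the inverse is
  \<open>converse\<close>.\<close>

definition linear_operator ::
  "('a::complex_normed_space \<times> 'b::complex_normed_space) set \<Rightarrow> bool" where
  "linear_operator T \<longleftrightarrow> single_valued T \<and> (0, 0) \<in> T \<and>
     (\<forall>x u y v. (x, u) \<in> T \<longrightarrow> (y, v) \<in> T \<longrightarrow> (x + y, u + v) \<in> T) \<and>
     (\<forall>c x u. (x, u) \<in> T \<longrightarrow> (c *\<^sub>C x, c *\<^sub>C u) \<in> T)"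

definition densely_defined ::
  "('a::complex_normed_space \<times> 'b::complex_normed_space) set \<Rightarrow> bool" where
  "densely_defined T \<longleftrightarrow> closure (Domain T) = UNIV"

definition op_kernel ::
  "('a::complex_normed_space \<times> 'b::complex_normed_space) set \<Rightarrow> 'a set" where
  "op_kernel T = {x. (x, 0) \<in> T}"

definition op_adjoint ::
  "('a::complex_hilbert \<times> 'b::complex_hilbert) set \<Rightarrow> ('b \<times> 'a) set" where
  "op_adjoint T = {(y, w). \<forall>(x, v) \<in> T. cinner v y = cinner x w}"

definition self_adjoint :: "('a::complex_hilbert \<times> 'a) set \<Rightarrow> bool" where
  "self_adjoint T \<longleftrightarrow> linear_operator T \<and> densely_defined T \<and> op_adjoint T = T"

definition op_add ::
  "('a \<times> 'b::complex_normed_space) set \<Rightarrow> ('a \<times> 'b) set \<Rightarrow> ('a \<times> 'b) set" where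
  "op_add S T = {(x, u + v) | x u v. (x, u) \<in> S \<and> (x, v) \<in> T}"

definition op_scale ::
  "complex \<Rightarrow> ('a \<times> 'b::complex_normed_space) set \<Rightarrow> ('a \<times> 'b) set" where
  "op_scale c T = {(x, c *\<^sub>C u) | x u. (x, u) \<in> T}"

definition resolvent ::
  "('a::complex_normed_space \<times> 'a) set \<Rightarrow> complex \<Rightarrow> ('a \<times> 'a) set" where
  "resolvent T z = converse (op_add T (op_scale (- z) Id))"

definition op_graph ::
  "'a::real_normed_vector \<Rightarrow>\<^sub>L 'b::real_normed_vector \<Rightarrow> ('a \<times> 'b) set" where
  "op_graph T = {(x, blinfun_apply T x) | x. True}"

definition compact_operator ::
  "('a::complex_normed_space \<Rightarrow>\<^sub>L 'b::complex_normed_space) \<Rightarrow> bool" where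
  "compact_operator T \<longleftrightarrow>
     linear_operator (op_graph T) \<and> compact (closure (blinfun_apply T ` cball 0 1))"

definition relatively_compact ::
  "('a::complex_normed_space \<times> 'b::complex_normed_space) set \<Rightarrow> ('a \<times> 'a) set \<Rightarrow> bool" where
  "relatively_compact V H \<longleftrightarrow>
     (\<forall>z. Im z \<noteq> 0 \<longrightarrow> (\<exists>C. compact_operator C \<and> resolvent H z O V = op_graph C))"

section \<open>Imaginary part and square root of a bounded operator\<close>

definition bounded_adjoint ::
  "('a::complex_hilbert \<Rightarrow>\<^sub>L 'b::complex_hilbert) \<Rightarrow> ('b \<Rightarrow>\<^sub>L 'a)" where
  "bounded_adjoint T =
     (THE S. \<forall>x y. cinner (blinfun_apply T x) y = cinner x (blinfun_apply S y))"

definition op_Im :: "('a::complex_hilbert \<Rightarrow>\<^sub>L 'a) \<Rightarrow> ('a \<Rightarrow>\<^sub>L 'a)" where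
  "op_Im T = (1 / (2 * \<i>)) *\<^sub>C (T - bounded_adjoint T)"

definition positive_operator :: "('a::complex_hilbert \<Rightarrow>\<^sub>L 'a) \<Rightarrow> bool" where
  "positive_operator S \<longleftrightarrow>
     self_adjoint (op_graph S) \<and> (\<forall>x. 0 \<le> Re (cinner x (blinfun_apply S x)))"

text \<open>The positive square root of a positive operator exists and is unique.\<close>

definition op_sqrt :: "('a::complex_hilbert \<Rightarrow>\<^sub>L 'a) \<Rightarrow> ('a \<Rightarrow>\<^sub>L 'a)" where
  "op_sqrt P = (SOME S. positive_operator S \<and> S o\<^sub>L S = P)"

section \<open>Holomorphic and meromorphic vector-valued functions\<close>

text \<open>The two-sided derivative \<open>at s\<close> is used, so on a set that is not open this means
  complex differentiability at each of its points, as a function on a neighbourhood.\<close>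

definition holomorphic_at_each ::
  "(complex \<Rightarrow> 'b::complex_normed_space) \<Rightarrow> complex set \<Rightarrow> bool" where
  "holomorphic_at_each f S \<longleftrightarrow>
     (\<forall>s\<in>S. \<exists>D. (f has_derivative (\<lambda>h. h *\<^sub>C D)) (at s))"

text \<open>The value of a meromorphic function at a singularity is unspecified.\<close>

definition meromorphic_vec :: "(complex \<Rightarrow> 'b::complex_normed_space) \<Rightarrow> bool" where
  "meromorphic_vec f \<longleftrightarrow> (\<forall>p. \<exists>n::nat. \<exists>e>0. \<exists>g. holomorphic_at_each g (ball p e) \<and>
     (\<forall>s \<in> ball p e - {p}. (s - p) ^ n *\<^sub>C f s = g s))"

definition contour_integral_vec ::
  "(real \<Rightarrow> complex) \<Rightarrow> (complex \<Rightarrow> 'b::complex_normed_space) \<Rightarrow> 'b" where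
  "contour_integral_vec \<gamma> f =
     integral {0..1} (\<lambda>t. vector_derivative \<gamma> (at t within {0..1}) *\<^sub>C f (\<gamma> t))"

section \<open>The line of operators\<close>

definition op_line ::
  "('h::complex_hilbert \<times> 'h) set \<Rightarrow> ('h \<times> 'h) set \<Rightarrow> real \<Rightarrow> ('h \<times> 'h) set" where
  "op_line H0 V r = op_add H0 (op_scale (of_real r) V)"

text \<open>The operator \<open>T\<^sub>z(H)\<close>, for non-real \<open>z\<close>: the compact extension of
  \<open>F (H - z)\<inverse> F\<^sup>*\<close>, which is unique because \<open>F\<^sup>*\<close> is densely defined.\<close>

definition is_sandwiched_resolvent ::
  "('h::complex_hilbert \<times> 'k::complex_hilbert) set \<Rightarrow> ('h \<times> 'h) set \<Rightarrow> complex \<Rightarrow>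
   ('k \<Rightarrow>\<^sub>L 'k) \<Rightarrow> bool" where
  "is_sandwiched_resolvent F H z T \<longleftrightarrow>
     compact_operator T \<and> op_adjoint F O resolvent H z O F \<subseteq> op_graph T"

definition sandwiched_resolvent ::
  "('h::complex_hilbert \<times> 'k::complex_hilbert) set \<Rightarrow> ('h \<times> 'h) set \<Rightarrow> complex \<Rightarrow>
   ('k \<Rightarrow>\<^sub>L 'k)" where
  "sandwiched_resolvent F H z = (THE T. is_sandwiched_resolvent F H z T)"

text \<open>The norm limit \<open>T\<^bsub>lam+i0\<^esub>(H)\<close> for \<open>\<sigma> = 1\<close>, and
  \<open>T\<^bsub>lam-i0\<^esub>(H)\<close> for \<open>\<sigma> = -1\<close>.\<close>

definition boundary_resolvent ::
  "('h::complex_hilbert \<times> 'k::complex_hilbert) set \<Rightarrow> ('h \<times> 'h) set \<Rightarrow> real \<Rightarrow> real \<Rightarrow>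
   ('k \<Rightarrow>\<^sub>L 'k)" where
  "boundary_resolvent F H lam \<sigma> =
     Lim (at_right 0) (\<lambda>y. sandwiched_resolvent F H (Complex lam (\<sigma> * y)))"

definition regular_points ::
  "('h::complex_hilbert \<times> 'h) set \<Rightarrow> ('h \<times> 'k::complex_hilbert) set \<Rightarrow> real set" where
  "regular_points H F = {lam. \<forall>\<sigma>\<in>{1, -1}. \<exists>L.
     ((\<lambda>y. sandwiched_resolvent F H (Complex lam (\<sigma> * y))) \<longlongrightarrow> L) (at_right 0)}"

locale operator_line =
  fixes H0 V :: "('h::complex_hilbert \<times> 'h) set"
    and F :: "('h \<times> 'k::complex_hilbert) set"
    and J :: "'k \<Rightarrow>\<^sub>L 'k"
  assumes separable: "separable_space (euclidean :: 'h topology)"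
      "separable_space (euclidean :: 'k topology)"
    and F_operator: "linear_operator F" "closed F" "densely_defined F"
    and F_kernel: "op_kernel F = {0}"
    and F_cokernel: "op_kernel (op_adjoint F) = {0}"
    and J_self_adjoint: "self_adjoint (op_graph J)"
    and V_factorization: "V = F O op_graph J O op_adjoint F"
    and V_self_adjoint: "self_adjoint V"
    and H_self_adjoint: "self_adjoint (op_line H0 V r)"
    and H_domain: "Domain (op_line H0 V r) = Domain H0"
    and domain_subset: "Domain H0 \<subseteq> Domain F \<inter> Domain V"
    and V_relatively_compact: "relatively_compact V (op_line H0 V r)"
    and compact_extension:
      "Im z \<noteq> 0 \<Longrightarrow> \<exists>T. is_sandwiched_resolvent F (op_line H0 V r) z T"
    and full_measure: "negligible (- regular_points (op_line H0 V r) F)"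

definition non_resonant ::
  "('h::complex_hilbert \<times> 'h) set \<Rightarrow> ('h \<times> 'h) set \<Rightarrow> ('h \<times> 'k::complex_hilbert) set \<Rightarrow>
   real \<Rightarrow> real \<Rightarrow> bool" where
  "non_resonant H0 V F lam r \<longleftrightarrow> lam \<in> regular_points (op_line H0 V r) F"

definition regular_line ::
  "('h::complex_hilbert \<times> 'h) set \<Rightarrow> ('h \<times> 'h) set \<Rightarrow> ('h \<times> 'k::complex_hilbert) set \<Rightarrow>
   real \<Rightarrow> bool" where
  "regular_line H0 V F lam \<longleftrightarrow> (\<exists>r. non_resonant H0 V F lam r)"

section \<open>Resonance vectors\<close>

text \<open>In the following definitions \<open>A\<close> stands for the operator-valued meromorphic function
  \<open>s \<mapsto> A\<^sub>z(s)\<close> with \<open>z = lam + i0\<close> (\<open>\<sigma> = 1\<close>) or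
  \<open>z = lam - i0\<close> (\<open>\<sigma> = -1\<close>), which is determined, up to its values at
  singularities, by the following predicate.\<close>

definition meromorphic_continuation ::
  "('h::complex_hilbert \<times> 'h) set \<Rightarrow> ('h \<times> 'h) set \<Rightarrow> ('h \<times> 'k::complex_hilbert) set \<Rightarrow>
   ('k \<Rightarrow>\<^sub>L 'k) \<Rightarrow> real \<Rightarrow> real \<Rightarrow> (complex \<Rightarrow> 'k \<Rightarrow>\<^sub>L 'k) \<Rightarrow> bool" where
  "meromorphic_continuation H0 V F J lam \<sigma> A \<longleftrightarrow> meromorphic_vec A \<and>
     (\<forall>s. non_resonant H0 V F lam s \<longrightarrow>
        A (of_real s) = boundary_resolvent F (op_line H0 V s) lam \<sigma> o\<^sub>L J)"

text \<open>The space \<open>\<Upsilon>\<^sup>k\<^sub>z(r)\<close>; it does not depend on the non-resonant real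
  number \<open>s\<close>.\<close>

definition resonance_space ::
  "(complex \<Rightarrow> 'k::complex_hilbert \<Rightarrow>\<^sub>L 'k) \<Rightarrow> real \<Rightarrow> real \<Rightarrow> nat \<Rightarrow> 'k set" where
  "resonance_space A s r k =
     {u. ((\<lambda>x. x + (r - s) *\<^sub>R blinfun_apply (A (of_real s)) x) ^^ k) u = 0}"

definition has_order ::
  "(complex \<Rightarrow> 'k::complex_hilbert \<Rightarrow>\<^sub>L 'k) \<Rightarrow> real \<Rightarrow> real \<Rightarrow> 'k \<Rightarrow> nat \<Rightarrow> bool" where
  "has_order A s r u k \<longleftrightarrow>
     1 \<le> k \<and> u \<in> resonance_space A s r k \<and> u \<notin> resonance_space A s r (k - 1)"

definition resonance_nilpotent ::
  "(complex \<Rightarrow> 'k::complex_hilbert \<Rightarrow>\<^sub>L 'k) \<Rightarrow> real \<Rightarrow> real \<Rightarrow> 'k \<Rightarrow>\<^sub>L 'k" where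
  "resonance_nilpotent A r \<rho> = (1 / (2 * pi * \<i>)) *\<^sub>C
     contour_integral_vec (circlepath (of_real r) \<rho>) (\<lambda>s. (s - of_real r) *\<^sub>C A s)"

text \<open>The whole space \<open>\<Upsilon>\<^sub>z(r)\<close> is \<open>\<Union>n. resonance_space A s r n\<close>.
  In the second condition the boundary value from above, \<open>lam + i0\<close>, is used for vectors of
  either sign.\<close>

definition type_I ::
  "('h::complex_hilbert \<times> 'h) set \<Rightarrow> ('h \<times> 'h) set \<Rightarrow> ('h \<times> 'k::complex_hilbert) set \<Rightarrow>
   ('k \<Rightarrow>\<^sub>L 'k) \<Rightarrow> real \<Rightarrow> (complex \<Rightarrow> 'k \<Rightarrow>\<^sub>L 'k) \<Rightarrow> real \<Rightarrow> real \<Rightarrow> 'k \<Rightarrow> bool" where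
  "type_I H0 V F J lam A s r u \<longleftrightarrow> u \<in> (\<Union>n. resonance_space A s r n) \<and>
     (\<forall>t. non_resonant H0 V F lam t \<longrightarrow>
        blinfun_apply (op_sqrt (op_Im (boundary_resolvent F (op_line H0 V t) lam 1)))
          (blinfun_apply J u) = 0)"

end

theory Submission
  imports Defs
begin

text \<open>Write \<open>h = t - r\<close> for real \<open>t\<close> near the resonance point \<open>r\<close>, and let \<open>u\<close> have order \<open>k\<close>. The
  resolvent identity gives \<open>A(t) u = \<Sum>\<^sub>j\<^sub><\<^sub>k h\<^sup>-\<^sup>1\<^sup>-\<^sup>j \<^bold>A\<^sup>j u\<close>. It also shows that the quadratic form of
  \<open>Im T\<close> at a fixed non-resonant \<open>t\<^sub>0\<close>, evaluated at \<open>J y\<close> for \<open>y = (1 + (t\<^sub>0 - t) A(t)) u\<close>, equals up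
  to sign \<open>Im \<langle>J u, A(t) u\<rangle>\<close>, which is \<open>O(h\<^sup>-\<^sup>k)\<close>. On the other hand this value is the squared norm of
  a vector-valued Laurent polynomial in \<open>h\<close> with coefficients
  \<open>S J ((r - t\<^sub>0) \<^bold>A\<^sup>j u + \<^bold>A\<^sup>j\<^sup>+\<^sup>1 u)\<close>, where \<open>S\<close> is the square root of \<open>Im T\<close> at \<open>t\<^sub>0\<close>. Hence the coefficient
  of \<open>h\<^sup>-\<^sup>1\<^sup>-\<^sup>j\<close> vanishes whenever \<open>2(j + 1) > k\<close>, and descending induction on \<open>j\<close> gives
  \<open>S J \<^bold>A\<^sup>j u = 0\<close> for these \<open>j\<close>.\<close>

section \<open>Complex Hilbert spaces\<close>

text \<open>The vanishing comes from a mismatch of growth rates: \<open>y\<close> may have a pole of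
  order \<open>k\<close> in \<open>h\<close>, so its squared norm could grow like h^(-2k), while the
  form of \<open>J u\<close> against \<open>A(t) u\<close> grows at most like h^(-k). The form is
  transported to a fixed \<open>t0\<close> because the square root there does not move with
  \<open>h\<close>, and because type I quantifies over all such points. Two obstacles shape the
  proof. The resolvent identity is available only at real non-resonant points, whereas the residue
  defining the nilpotent runs over a complex circle; so the identity is continued analytically.
  Moreover, real points near \<open>r\<close> must be shown to be non-resonant: holomorphy of
  \<open>A\<close> does not by itself produce the norm limits of the sandwiched resolvents. They are
  obtained from a lower bound for 1 + (t - s) A(s). The expansion of \<open>A(t) u\<close> is
  algebraic: on the kernel of the k-th power of 1 + (r - s) A(s), \<open>A(w)\<close> inverts (w -
  r) - N for an explicit nilpotent \<open>N\<close>, and the residue then identifies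
  \<open>N\<close> with the operator of the statement.\<close>

lemma scaleC_one [simp]: "1 *\<^sub>C x = x"
  using scaleC_of_real[of 1 x] by simp

lemma scaleC_zero_left [simp]: "0 *\<^sub>C x = 0"
  using scaleC_of_real[of 0 x] by simp

lemma scaleC_zero_right [simp]: "c *\<^sub>C 0 = 0"
  using norm_scaleC[of c 0] by simp

lemma scaleC_minus_left [simp]: "(- c) *\<^sub>C x = - (c *\<^sub>C x)"
  using scaleC_add_left[of c "- c" x] by (simp add: eq_neg_iff_add_eq_0 add.commute)

lemma scaleC_minus_right [simp]: "c *\<^sub>C (- x) = - (c *\<^sub>C x)"
  using scaleC_add_right[of c x "- x"] by (simp add: eq_neg_iff_add_eq_0 add.commute)

lemma scaleC_diff_right: "c *\<^sub>C (x - y) = c *\<^sub>C x - c *\<^sub>C y"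
  using scaleC_add_right[of c x "- y"] by simp

lemma scaleR_scaleC_commute: "c *\<^sub>C r *\<^sub>R x = r *\<^sub>R c *\<^sub>C x"
  by (simp add: scaleC_scaleC mult.commute flip: scaleC_of_real)

lemma bounded_bilinear_scaleC:
  "bounded_bilinear (scaleC :: complex \<Rightarrow> 'a::complex_normed_space \<Rightarrow> 'a)"
proof
  fix a a' :: complex and b b' :: 'a and r :: real
  show "(a + a') *\<^sub>C b = a *\<^sub>C b + a' *\<^sub>C b" by (rule scaleC_add_left)
  show "a *\<^sub>C (b + b') = a *\<^sub>C b + a *\<^sub>C b'" by (rule scaleC_add_right)
  show "(r *\<^sub>R a) *\<^sub>C b = r *\<^sub>R a *\<^sub>C b"
    by (simp add: scaleR_conv_of_real scaleC_scaleC flip: scaleC_of_real)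
  show "a *\<^sub>C r *\<^sub>R b = r *\<^sub>R a *\<^sub>C b" by (rule scaleR_scaleC_commute)
  show "\<exists>K. \<forall>a b. norm (a *\<^sub>C b :: 'a) \<le> norm a * norm b * K"
    by (intro exI[of _ 1]) (simp add: norm_scaleC)
qed

interpretation scaleC: bounded_bilinear scaleC
  by (rule bounded_bilinear_scaleC)

lemma cinner_add_left: "cinner (x + y) z = cinner x z + cinner y z"
  by (metis cinner_commute cinner_add_right complex_cnj_add)

lemma cinner_scaleC_left: "cinner (c *\<^sub>C x) y = cnj c * cinner x y"
  by (metis cinner_commute cinner_scaleC_right complex_cnj_mult complex_cnj_cnj)

lemma cinner_scaleR_right: "cinner x (r *\<^sub>R y) = of_real r * cinner x y"
  by (simp add: cinner_scaleC_right flip: scaleC_of_real)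

lemma cinner_scaleR_left: "cinner (r *\<^sub>R x) y = of_real r * cinner x y"
  by (simp add: cinner_scaleC_left flip: scaleC_of_real)

lemma cinner_conv_inner: "cinner x y = Complex (inner x y) (- inner x (\<i> *\<^sub>C y))"
  by (simp add: complex_eq_iff cinner_scaleC_right flip: Re_cinner)

text \<open>The factor 2 comes from estimating real and imaginary part separately. This crude
  constant suffices for continuity and for bounds up to a constant.\<close>

lemma norm_cinner_le: "norm (cinner x y) \<le> norm x * norm y * 2"
proof -
  have "norm (cinner x y) \<le> \<bar>inner x y\<bar> + \<bar>inner x (\<i> *\<^sub>C y)\<bar>"
    using cmod_le[of "cinner x y"] by (simp add: cinner_conv_inner)
  also have "\<dots> \<le> norm x * norm y + norm x * norm (\<i> *\<^sub>C y)"
    by (intro add_mono Cauchy_Schwarz_ineq2)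
  finally show ?thesis by (simp add: norm_scaleC)
qed

lemma bounded_bilinear_cinner:
  "bounded_bilinear (cinner :: 'a::complex_hilbert \<Rightarrow> 'a \<Rightarrow> complex)"
proof
  show "\<exists>K. \<forall>a b::'a. norm (cinner a b) \<le> norm a * norm b * K"
    using norm_cinner_le by blast
qed (simp_all add: cinner_add_left cinner_add_right cinner_scaleR_left cinner_scaleR_right
       scaleR_conv_of_real)

interpretation cinner: bounded_bilinear cinner
  by (rule bounded_bilinear_cinner)

lemma Im_cinner_self [simp]: "Im (cinner x x) = 0"
  using arg_cong[OF cinner_commute[of x x], of Im] by simp

lemma cinner_self: "cinner x x = of_real ((norm x)\<^sup>2)"
  by (simp add: complex_eq_iff Re_cinner power2_norm_eq_inner)

lemma cinner_ext:
  assumes "\<And>y. cinner y x = cinner y x'"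
  shows "x = x'"
proof -
  have "cinner (x - x') (x - x') = 0"
    using assms[of "x - x'"] by (simp add: cinner.diff_right)
  then show ?thesis by (simp add: cinner_self)
qed

text \<open>A minimizing sequence for the distance is Cauchy by the parallelogram law, and its limit
  is a closest point. Only the real inner product enters, so the result also applies to a graph
  inside a product space.\<close>

lemma orthogonal_decomposition:
  fixes S :: "'a::{real_inner,banach} set"
  assumes "closed S" "subspace S"
  obtains p where "p \<in> S" "\<And>y. y \<in> S \<Longrightarrow> inner (x - p) y = 0"
proof -
  define d where "d = infdist x S"
  have ne: "S \<noteq> {}" using assms(2) subspace_0 by blast
  have dle: "d \<le> dist x y" if "y \<in> S" for y
    unfolding d_def using that by (rule infdist_le)
  have d0: "0 \<le> d" by (simp add: d_def infdist_nonneg)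
  have ex: "\<exists>y\<in>S. (dist x y)\<^sup>2 < d\<^sup>2 + inverse (real (Suc n))" for n
  proof -
    define e where "e = sqrt (d\<^sup>2 + inverse (real (Suc n)))"
    have "d < e" unfolding e_def using d0 by (intro real_less_rsqrt) auto
    then have "\<exists>y\<in>S. dist x y < e"
      unfolding d_def infdist_notempty[OF ne] using ne
      by (subst (asm) cINF_less_iff) auto
    then obtain y where "y \<in> S" "dist x y < e" by blast
    moreover from this have "(dist x y)\<^sup>2 < e\<^sup>2" by (intro power_strict_mono) auto
    ultimately show ?thesis unfolding e_def by (auto simp: add_nonneg_nonneg)
  qed
  then obtain y where y: "\<And>n. y n \<in> S"
    and yd: "\<And>n. (dist x (y n))\<^sup>2 < d\<^sup>2 + inverse (real (Suc n))"
    by metis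
  \<comment> \<open>The midpoint \<open>w\<close> stays in \<open>S\<close>, so its distance to
    \<open>x\<close> is at least \<open>d\<close>; the terms \<open>d^2\<close> then cancel in the
    parallelogram identity.\<close>
  have para: "(dist (y m) (y n))\<^sup>2 \<le> 2 * inverse (real (Suc m)) + 2 * inverse (real (Suc n))" for m n
  proof -
    define w where "w = (1/2) *\<^sub>R (y m + y n)"
    have "w \<in> S" unfolding w_def by (intro subspace_scale subspace_add assms y)
    then have "d\<^sup>2 \<le> (dist x w)\<^sup>2" using dle d0 by (intro power_mono) auto
    moreover have "(dist (y m) (y n))\<^sup>2 =
        2 * (dist x (y m))\<^sup>2 + 2 * (dist x (y n))\<^sup>2 - 4 * (dist x w)\<^sup>2"
      unfolding w_def dist_norm power2_norm_eq_inner
      by (simp add: inner_diff_left inner_diff_right inner_add_left inner_add_right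
          inner_commute algebra_simps)
    ultimately show ?thesis using yd[of m] yd[of n] by linarith
  qed
  have "Cauchy y"
  proof (rule metric_CauchyI)
    fix e :: real assume e: "e > 0"
    then obtain N where N: "inverse (real (Suc N)) < e\<^sup>2 / 4"
      using reals_Archimedean[of "e\<^sup>2 / 4"] by auto
    show "\<exists>M. \<forall>m\<ge>M. \<forall>n\<ge>M. dist (y m) (y n) < e"
    proof (intro exI[of _ N] allI impI)
      fix m n assume mn: "N \<le> m" "N \<le> n"
      have "inverse (real (Suc m)) \<le> inverse (real (Suc N))"
        "inverse (real (Suc n)) \<le> inverse (real (Suc N))"
        using mn by (auto intro!: le_imp_inverse_le)
      then have "(dist (y m) (y n))\<^sup>2 < e\<^sup>2" using para[of m n] N by linarith
      then show "dist (y m) (y n) < e" using e by (simp add: power_less_imp_less_base)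
    qed
  qed
  then obtain p where p: "y \<longlonglongrightarrow> p" using Cauchy_convergent convergent_def by blast
  have pS: "p \<in> S" using closed_sequentially[OF assms(1) y p] .
  have "(dist x p)\<^sup>2 \<le> d\<^sup>2 + 0"
  proof (rule LIMSEQ_le)
    show "(\<lambda>n. (dist x (y n))\<^sup>2) \<longlonglongrightarrow> (dist x p)\<^sup>2" by (intro tendsto_intros p)
    show "(\<lambda>n. d\<^sup>2 + inverse (real (Suc n))) \<longlonglongrightarrow> d\<^sup>2 + 0"
      by (intro tendsto_intros LIMSEQ_inverse_real_of_nat)
  qed (use yd less_imp_le in blast)
  then have "dist x p \<le> d" using d0 by (auto dest: power2_le_imp_le)
  then have min: "\<forall>z\<in>S. dist x p \<le> dist x z" using dle order_trans by blast
  \<comment> \<open>Minimality over the convex set \<open>S\<close>, tested at \<open>p + z\<close>,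
    gives one inequality; \<open>- z\<close> will give the other.\<close>
  have le: "inner (x - p) z \<le> 0" if "z \<in> S" for z
    using any_closest_point_dot[OF subspace_imp_convex[OF assms(2)] assms(1) pS _ min, of "p + z"]
      subspace_add[OF assms(2) pS that] by simp
  have "inner (x - p) z = 0" if "z \<in> S" for z
    using le[OF that] le[OF subspace_neg[OF assms(2) that]] by simp
  with pS show ?thesis by (rule that)
qed

lemma subspace_closure:
  fixes S :: "'a::real_normed_vector set"
  assumes "subspace S"
  shows "subspace (closure S)"
proof (rule subspaceI)
  show "0 \<in> closure S" using subspace_0[OF assms] closure_subset by blast
next
  fix x y assume "x \<in> closure S" "y \<in> closure S"
  then obtain f g where "\<And>n. f n \<in> S" "f \<longlonglongrightarrow> x" "\<And>n. g n \<in> S" "g \<longlonglongrightarrow> y"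
    unfolding closure_sequential by metis
  then show "x + y \<in> closure S"
    unfolding closure_sequential
    by (intro exI[of _ "\<lambda>n. f n + g n"]) (auto intro: subspace_add[OF assms] tendsto_add)
next
  fix x and c :: real assume "x \<in> closure S"
  then obtain f where "\<And>n. f n \<in> S" "f \<longlonglongrightarrow> x"
    unfolding closure_sequential by metis
  then show "c *\<^sub>R x \<in> closure S"
    unfolding closure_sequential
    by (intro exI[of _ "\<lambda>n. c *\<^sub>R f n"]) (auto intro: subspace_scale[OF assms] tendsto_scaleR)
qed

lemma op_adjoint_iff:
  "(y, w) \<in> op_adjoint T \<longleftrightarrow> (\<forall>x v. (x, v) \<in> T \<longrightarrow> cinner v y = cinner x w)"
  by (auto simp: op_adjoint_def)

lemma linear_operator_imp_subspace: "linear_operator F \<Longrightarrow> subspace F"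
  unfolding linear_operator_def
  by (intro subspaceI) (auto simp: zero_prod_def simp flip: scaleC_of_real)

text \<open>The orthogonal projection of \<open>(0, v)\<close> onto the graph of \<open>F\<close> has, for \<open>v\<close>
  orthogonal to the domain of the adjoint, vanishing complementary part.\<close>

lemma adjoint_densely_defined:
  fixes F :: "('a::complex_hilbert \<times> 'b::complex_hilbert) set"
  assumes F: "linear_operator F" "closed F"
  shows "closure (Domain (op_adjoint F)) = UNIV"
proof -
  let ?D = "Domain (op_adjoint F)"
  have sub: "subspace ?D"
  proof (rule subspaceI)
    have "(0, 0) \<in> op_adjoint F" by (simp add: op_adjoint_iff cinner.zero_right)
    then show "0 \<in> ?D" by blast
  next
    fix x y assume "x \<in> ?D" "y \<in> ?D"
    then obtain w w' where "(x, w) \<in> op_adjoint F" "(y, w') \<in> op_adjoint F" by blast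
    then have "(x + y, w + w') \<in> op_adjoint F"
      by (simp add: op_adjoint_iff cinner_add_right)
    then show "x + y \<in> ?D" by blast
  next
    fix x and c :: real assume "x \<in> ?D"
    then obtain w where "(x, w) \<in> op_adjoint F" by blast
    then have "(c *\<^sub>R x, c *\<^sub>R w) \<in> op_adjoint F"
      by (simp add: op_adjoint_iff cinner_scaleR_right)
    then show "c *\<^sub>R x \<in> ?D" by blast
  qed
  have "x \<in> closure ?D" for x
  proof -
    obtain p where p: "p \<in> closure ?D" "\<And>y. y \<in> closure ?D \<Longrightarrow> inner (x - p) y = 0"
      using orthogonal_decomposition[OF closed_closure subspace_closure[OF sub]] by metis
    define v where "v = x - p"
    obtain q where q: "q \<in> F" "\<And>y. y \<in> F \<Longrightarrow> inner ((0, v) - q) y = 0"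
      using orthogonal_decomposition[OF F(2) linear_operator_imp_subspace[OF F(1)]] by metis
    obtain a b where ab: "(0, v) - q = (a, b)" by fastforce
    have orth: "inner a x' + inner b y' = 0" if "(x', y') \<in> F" for x' y'
      using q(2)[OF that] by (simp add: ab inner_prod_def)
    \<comment> \<open>Orthogonality for the real inner product yields only the real part. The
      imaginary part comes from the pair multiplied by \<i>, which stays in the complex subspace
      \<open>F\<close>.\<close>
    have "cinner y' b = cinner x' (- a)" if F': "(x', y') \<in> F" for x' y'
    proof (rule complex_eqI)
      show "Re (cinner y' b) = Re (cinner x' (- a))"
        using orth[OF F'] by (simp add: Re_cinner inner_commute)
      have "(\<i> *\<^sub>C x', \<i> *\<^sub>C y') \<in> F" using F(1) F' by (auto simp: linear_operator_def)
      from orth[OF this] have "Re (cinner (\<i> *\<^sub>C y') b) = Re (cinner (\<i> *\<^sub>C x') (- a))"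
        by (simp add: Re_cinner inner_commute)
      then show "Im (cinner y' b) = Im (cinner x' (- a))" by (simp add: cinner_scaleC_left)
    qed
    then have "(b, - a) \<in> op_adjoint F" by (simp add: op_adjoint_iff)
    then have "b \<in> closure ?D" by (intro subsetD[OF closure_subset] DomainI)
    then have "inner v b = 0" using p(2) by (simp add: v_def)
    have split: "(0, v) = q + (a, b)" by (simp only: ab[symmetric]) simp
    have "inner (a, b) q = 0" using q(2)[OF q(1)] by (simp only: ab)
    then have "inner (a, b) (a, b) = inner (a, b) (0, v)"
      by (simp only: split inner_add_right)
    also have "\<dots> = 0" using \<open>inner v b = 0\<close> by (simp add: inner_prod_def inner_commute)
    finally have "(a, b) = 0" by (simp only: inner_eq_zero_iff)
    then have "(0, v) \<in> F" using split q(1) by (simp only: add_0_right)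
    then have "v = 0"
      using F(1) by (auto simp: linear_operator_def dest: single_valuedD)
    then show ?thesis using p(1) by (simp add: v_def)
  qed
  then show ?thesis by blast
qed

section \<open>Bounded operators: density arguments, adjoint pairs, complex linearity and
  limits\<close>

lemma blinfun_eq_on_dense:
  fixes S T :: "'a::real_normed_vector \<Rightarrow>\<^sub>L 'b::real_normed_vector"
  assumes "closure D = UNIV" "\<And>x. x \<in> D \<Longrightarrow> blinfun_apply S x = blinfun_apply T x"
  shows "S = T"
proof (rule blinfun_eqI)
  fix x
  have "closed {x. blinfun_apply S x = blinfun_apply T x}"
    by (intro closed_Collect_eq continuous_intros)
  then have "closure D \<subseteq> {x. blinfun_apply S x = blinfun_apply T x}"
    using assms(2) by (intro closure_minimal) auto
  then show "blinfun_apply S x = blinfun_apply T x" using assms(1) by auto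
qed

text \<open>A relation, because all adjoints occurring here are given explicitly; so the Riesz
  representation theorem is not needed.\<close>

definition adjoint_pair ::
  "('a::complex_hilbert \<Rightarrow>\<^sub>L 'b::complex_hilbert) \<Rightarrow> ('b \<Rightarrow>\<^sub>L 'a) \<Rightarrow> bool" where
  "adjoint_pair S T \<longleftrightarrow> (\<forall>x y. cinner (blinfun_apply S x) y = cinner x (blinfun_apply T y))"

definition complex_linear ::
  "('a::complex_normed_space \<Rightarrow>\<^sub>L 'b::complex_normed_space) \<Rightarrow> bool" where
  "complex_linear T \<longleftrightarrow> (\<forall>c x. blinfun_apply T (c *\<^sub>C x) = c *\<^sub>C blinfun_apply T x)"

lemma linear_operator_op_graph: "linear_operator (op_graph T) \<longleftrightarrow> complex_linear T"
  by (auto simp: linear_operator_def op_graph_def complex_linear_def single_valued_def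
      blinfun.add_right blinfun.zero_right)

lemma adjoint_pair_commute: "adjoint_pair S T \<longleftrightarrow> adjoint_pair T S"
  unfolding adjoint_pair_def by (metis cinner_commute complex_cnj_cnj)

lemma adjoint_pair_unique:
  assumes "adjoint_pair S T" "adjoint_pair S T'"
  shows "T = T'"
proof (intro blinfun_eqI cinner_ext)
  fix x y show "cinner y (blinfun_apply T x) = cinner y (blinfun_apply T' x)"
    using assms unfolding adjoint_pair_def by metis
qed

lemma bounded_adjoint_eq: "adjoint_pair S T \<Longrightarrow> bounded_adjoint S = T"
  unfolding bounded_adjoint_def
  by (rule the_equality) (auto simp: adjoint_pair_def[symmetric] intro: adjoint_pair_unique)

lemma adjoint_pair_diff:
  "adjoint_pair S T \<Longrightarrow> adjoint_pair S' T' \<Longrightarrow> adjoint_pair (S - S') (T - T')"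
  by (simp add: adjoint_pair_def blinfun.diff_left cinner.diff_left cinner.diff_right)

text \<open>The squared norm of \<open>T y\<close> is the form of \<open>S (T y)\<close> against
  \<open>y\<close>; Cauchy-Schwarz and division by the norm of \<open>T y\<close> finish. Equality
  of the two norms later carries Cauchy estimates across the real axis.\<close>

lemma adjoint_pair_norm_le:
  assumes "adjoint_pair S T"
  shows "norm T \<le> norm S"
proof (rule norm_blinfun_bound)
  fix y
  let ?x = "blinfun_apply T y"
  have "norm ?x * norm ?x = Re (cinner ?x ?x)"
    by (simp add: Re_cinner power2_norm_eq_inner flip: power2_eq_square)
  also have "\<dots> = Re (cinner (blinfun_apply S ?x) y)"
    using assms by (simp add: adjoint_pair_def)
  also have "\<dots> \<le> norm (blinfun_apply S ?x) * norm y"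
    unfolding Re_cinner by (rule norm_cauchy_schwarz)
  also have "\<dots> \<le> norm ?x * (norm S * norm y)"
    using mult_right_mono[OF norm_blinfun[of S ?x] norm_ge_zero[of y]] by (simp add: mult_ac)
  finally show "norm ?x \<le> norm S * norm y"
    by (cases "?x = 0") (auto simp: mult_le_cancel_left_pos)
qed simp

lemma adjoint_pair_norm: "adjoint_pair S T \<Longrightarrow> norm T = norm S"
  by (meson adjoint_pair_commute adjoint_pair_norm_le order_antisym)

lemma tendsto_cinner_blinfun:
  assumes "(f \<longlongrightarrow> S) Fl"
  shows "((\<lambda>y. cinner (blinfun_apply (f y) x) z) \<longlongrightarrow> cinner (blinfun_apply S x) z) Fl"
  by (intro cinner.tendsto blinfun.tendsto assms tendsto_const)

lemma adjoint_pair_tendsto: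
  assumes "\<forall>\<^sub>F y in Fl. adjoint_pair (f y) (g y)" "(f \<longlongrightarrow> S) Fl" "(g \<longlongrightarrow> T) Fl" "Fl \<noteq> bot"
  shows "adjoint_pair S T"
  unfolding adjoint_pair_def
proof (intro allI)
  fix x y
  have "((\<lambda>t. cinner (blinfun_apply (f t) x) y) \<longlongrightarrow> cinner (blinfun_apply S x) y) Fl"
    by (rule tendsto_cinner_blinfun) (rule assms)
  moreover have "((\<lambda>t. cinner x (blinfun_apply (g t) y)) \<longlongrightarrow> cinner x (blinfun_apply T y)) Fl"
    by (intro cinner.tendsto blinfun.tendsto assms tendsto_const)
  moreover have "\<forall>\<^sub>F t in Fl. cinner (blinfun_apply (f t) x) y = cinner x (blinfun_apply (g t) y)"
    using assms(1) by eventually_elim (simp add: adjoint_pair_def)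
  ultimately show "cinner (blinfun_apply S x) y = cinner x (blinfun_apply T y)"
    using tendsto_unique[OF assms(4)] Lim_transform_eventually by fast
qed

lemma complex_linear_tendsto:
  assumes "\<forall>\<^sub>F y in Fl. complex_linear (f y)" "(f \<longlongrightarrow> S) Fl" "Fl \<noteq> bot"
  shows "complex_linear S"
  unfolding complex_linear_def
proof (intro allI)
  fix c x
  have "((\<lambda>t. blinfun_apply (f t) (c *\<^sub>C x)) \<longlongrightarrow> blinfun_apply S (c *\<^sub>C x)) Fl"
    by (intro blinfun.tendsto assms tendsto_const)
  moreover have "((\<lambda>t. c *\<^sub>C blinfun_apply (f t) x) \<longlongrightarrow> c *\<^sub>C blinfun_apply S x) Fl"
    by (intro scaleC.tendsto blinfun.tendsto assms tendsto_const)
  moreover have "\<forall>\<^sub>F t in Fl. blinfun_apply (f t) (c *\<^sub>C x) = c *\<^sub>C blinfun_apply (f t) x"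
    using assms(1) by eventually_elim (simp add: complex_linear_def)
  ultimately show "blinfun_apply S (c *\<^sub>C x) = c *\<^sub>C blinfun_apply S x"
    using tendsto_unique[OF assms(3)] Lim_transform_eventually by fast
qed

section \<open>Sandwiched resolvents\<close>

context operator_line
begin

abbreviation H :: "real \<Rightarrow> ('h \<times> 'h) set" where "H \<equiv> op_line H0 V"

abbreviation T :: "real \<Rightarrow> complex \<Rightarrow> 'k \<Rightarrow>\<^sub>L 'k" where
  "T r z \<equiv> sandwiched_resolvent F (H r) z"

lemma adjoint_dense: "closure (Domain (op_adjoint F)) = UNIV"
  using adjoint_densely_defined F_operator by blast

text \<open>For \<open>x\<close> in the domain of the adjoint, \<open>w\<close> is \<open>(H\<^sub>r - z)\<inverse> F\<^sup>* x\<close> and \<open>g\<close> is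
  \<open>F w\<close>.\<close>

lemma sandwich_witness:
  assumes z: "Im z \<noteq> 0" and x: "x \<in> Domain (op_adjoint F)"
  obtains f w h v g where
    "(x, f) \<in> op_adjoint F" "(w, h) \<in> H0" "(w, v) \<in> V" "(w, g) \<in> F"
    "(blinfun_apply J g, v) \<in> op_adjoint F" "f = h + r *\<^sub>R v - z *\<^sub>C w"
proof -
  from x obtain f where f: "(x, f) \<in> op_adjoint F" by blast
  \<comment> \<open>Surjectivity of \<open>H r - z\<close> is read off from relative compactness:
    the composite is the graph of an everywhere defined operator, so every \<open>f\<close> has an
    image \<open>w\<close> under the resolvent.\<close>
  obtain C where C: "resolvent (H r) z O V = op_graph C"
    using V_relatively_compact[of r] z unfolding relatively_compact_def by blast
  have "(f, blinfun_apply C f) \<in> resolvent (H r) z O V" by (simp add: C op_graph_def)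
  then obtain w where "(f, w) \<in> resolvent (H r) z" by blast
  then obtain u where u: "(w, u) \<in> H r" "f = u - z *\<^sub>C w"
    unfolding resolvent_def op_add_def op_scale_def by auto
  then obtain h v where hv: "(w, h) \<in> H0" "(w, v) \<in> V" "u = h + r *\<^sub>R v"
    unfolding op_line_def op_add_def op_scale_def by (auto simp: scaleC_of_real)
  \<comment> \<open>The factorization of \<open>V\<close> puts \<open>J g\<close> into the domain of
    the adjoint of \<open>F\<close>, with image \<open>v\<close>. This is what lets the perturbation
    be absorbed into the argument \<open>x\<close> in the resolvent identity.\<close>
  from hv(2) obtain g where g: "(w, g) \<in> F" "(blinfun_apply J g, v) \<in> op_adjoint F"
    unfolding V_factorization op_graph_def by auto
  show ?thesis by (rule that[OF f hv(1,2) g]) (simp add: u hv)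
qed

lemma sandwich_memI:
  assumes "(x, f) \<in> op_adjoint F" "(w, h) \<in> H0" "(w, v) \<in> V" "(w, g) \<in> F"
    "f = h + r *\<^sub>R v - z *\<^sub>C w"
  shows "(x, g) \<in> op_adjoint F O resolvent (H r) z O F"
proof -
  have "(w, h + r *\<^sub>R v) \<in> H r"
    using assms unfolding op_line_def op_add_def op_scale_def by (force simp: scaleC_of_real)
  then have "(f, w) \<in> resolvent (H r) z"
    unfolding resolvent_def op_add_def op_scale_def assms(5)
    by (auto intro!: exI[of _ "- (z *\<^sub>C w)"] exI[of _ "h + r *\<^sub>R v"])
  with assms show ?thesis by blast
qed

lemma sandwich_unique:
  assumes "Im z \<noteq> 0" "is_sandwiched_resolvent F (H r) z S" "is_sandwiched_resolvent F (H r) z S'"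
  shows "S = S'"
proof (rule blinfun_eq_on_dense[OF adjoint_dense])
  fix x assume x: "x \<in> Domain (op_adjoint F)"
  obtain f w h v g where "(x, f) \<in> op_adjoint F" "(w, h) \<in> H0" "(w, v) \<in> V" "(w, g) \<in> F"
    "f = h + r *\<^sub>R v - z *\<^sub>C w"
    using sandwich_witness[OF assms(1) x, of r] by metis
  then have "(x, g) \<in> op_adjoint F O resolvent (H r) z O F" by (rule sandwich_memI)
  then show "blinfun_apply S x = blinfun_apply S' x"
    using assms(2,3) unfolding is_sandwiched_resolvent_def op_graph_def by auto
qed

lemma sandwiched_resolvent:
  assumes "Im z \<noteq> 0"
  shows "is_sandwiched_resolvent F (H r) z (T r z)"
proof -
  obtain S where S: "is_sandwiched_resolvent F (H r) z S" using compact_extension assms by blast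
  show ?thesis
    unfolding sandwiched_resolvent_def
    by (rule theI[where P = "is_sandwiched_resolvent F (H r) z" and a = S]) (use S sandwich_unique[OF assms] in auto)
qed

lemma complex_linear_T: "Im z \<noteq> 0 \<Longrightarrow> complex_linear (T r z)"
  using sandwiched_resolvent
  unfolding is_sandwiched_resolvent_def compact_operator_def linear_operator_op_graph by blast

lemma T_apply:
  assumes "Im z \<noteq> 0" "(x, f) \<in> op_adjoint F" "(w, h) \<in> H0" "(w, v) \<in> V" "(w, g) \<in> F"
    "f = h + r *\<^sub>R v - z *\<^sub>C w"
  shows "blinfun_apply (T r z) x = g"
  using sandwich_memI[OF assms(2-6)] sandwiched_resolvent[OF assms(1), of r]
  unfolding is_sandwiched_resolvent_def op_graph_def by blast

lemma op_adjoint_add_scaleR: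
  fixes c :: real
  assumes "(x, f) \<in> op_adjoint F" "(y, g) \<in> op_adjoint F"
  shows "(x + c *\<^sub>R y, f + c *\<^sub>R g) \<in> op_adjoint F"
  using assms by (simp add: op_adjoint_iff cinner_add_right cinner_scaleR_right)

text \<open>Let \<open>w\<close> be the resolvent of \<open>H r\<close> applied to \<open>f\<close>.
  Then (H_s - z) w = f + (s - r) V w is the adjoint of \<open>F\<close> at x + (s - r) J g. Hence
  the same \<open>w\<close>, and the same \<open>g = F w\<close>, computes \<open>T r z\<close> at
  \<open>x\<close> and \<open>T s z\<close> at the shifted argument.\<close>

lemma resolvent_identity:
  assumes z: "Im z \<noteq> 0"
  shows "T r z = T s z + (s - r) *\<^sub>R (T s z o\<^sub>L J o\<^sub>L T r z)"
proof (rule blinfun_eq_on_dense[OF adjoint_dense])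
  fix x assume x: "x \<in> Domain (op_adjoint F)"
  obtain f w h v g where *: "(x, f) \<in> op_adjoint F" "(w, h) \<in> H0" "(w, v) \<in> V" "(w, g) \<in> F"
    "(blinfun_apply J g, v) \<in> op_adjoint F" "f = h + r *\<^sub>R v - z *\<^sub>C w"
    by (rule sandwich_witness[OF z x, of r])
  have r: "blinfun_apply (T r z) x = g" by (rule T_apply[OF z *(1-4,6)])
  have "blinfun_apply (T s z) (x + (s - r) *\<^sub>R blinfun_apply J g) = g"
    by (rule T_apply[OF z op_adjoint_add_scaleR[OF *(1,5)] *(2-4)])
      (simp add: *(6) algebra_simps)
  then show "blinfun_apply (T r z) x =
      blinfun_apply (T s z + (s - r) *\<^sub>R (T s z o\<^sub>L J o\<^sub>L T r z)) x"
    by (simp add: r blinfun.add_left blinfun.scaleR_left blinfun.add_right blinfun.scaleR_right)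
qed

lemma H_symmetric:
  assumes "(w, h) \<in> H0" "(w, v) \<in> V" "(w', h') \<in> H0" "(w', v') \<in> V"
  shows "cinner (h + r *\<^sub>R v) w' = cinner w (h' + r *\<^sub>R v')"
proof -
  have "(w, h + r *\<^sub>R v) \<in> H r" "(w', h' + r *\<^sub>R v') \<in> H r"
    using assms unfolding op_line_def op_add_def op_scale_def by (force simp: scaleC_of_real)+
  moreover have "op_adjoint (H r) = H r"
    using H_self_adjoint by (simp add: self_adjoint_def)
  ultimately show ?thesis by (metis op_adjoint_iff)
qed

text \<open>For arguments in the dense domain both sides reduce to the symmetry of
  \<open>H r\<close> between the witnesses \<open>w\<close> and \<open>w'\<close>. Continuity then
  extends the relation in one variable at a time.\<close>

lemma adjoint_pair_T:
  assumes z: "Im z \<noteq> 0"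
  shows "adjoint_pair (T r z) (T r (cnj z))"
proof -
  have eq: "cinner (blinfun_apply (T r z) x) y = cinner x (blinfun_apply (T r (cnj z)) y)"
    if x: "x \<in> Domain (op_adjoint F)" and y: "y \<in> Domain (op_adjoint F)" for x y
  proof -
    have z': "Im (cnj z) \<noteq> 0" using z by simp
    obtain f w h v g where *: "(x, f) \<in> op_adjoint F" "(w, h) \<in> H0" "(w, v) \<in> V" "(w, g) \<in> F"
      "f = h + r *\<^sub>R v - z *\<^sub>C w"
      using sandwich_witness[OF z x, of r] by metis
    obtain f' w' h' v' g' where **: "(y, f') \<in> op_adjoint F" "(w', h') \<in> H0" "(w', v') \<in> V"
      "(w', g') \<in> F" "f' = h' + r *\<^sub>R v' - cnj z *\<^sub>C w'"
      using sandwich_witness[OF z' y, of r] by metis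
    have "cinner g y = cinner w f'" using *(4) **(1) by (simp add: op_adjoint_iff)
    also have "\<dots> = cinner (h + r *\<^sub>R v) w' - cnj z * cinner w w'"
      unfolding H_symmetric[OF *(2,3) **(2,3)]
      by (simp add: **(5) cinner.diff_right cinner_scaleC_right)
    also have "\<dots> = cinner f w'"
      by (simp add: *(5) cinner.diff_left cinner_scaleC_left)
    also have "\<dots> = cinner x g'"
      using *(1) **(4) by (metis cinner_commute op_adjoint_iff)
    finally show ?thesis by (simp add: T_apply[OF z *] T_apply[OF z' **])
  qed
  have eq': "cinner (blinfun_apply (T r z) x) y = cinner x (blinfun_apply (T r (cnj z)) y)"
    if x: "x \<in> Domain (op_adjoint F)" for x y
  proof -
    have "closed {y. cinner (blinfun_apply (T r z) x) y = cinner x (blinfun_apply (T r (cnj z)) y)}"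
      by (intro closed_Collect_eq cinner.continuous_on continuous_intros)
    then have "closure (Domain (op_adjoint F)) \<subseteq>
        {y. cinner (blinfun_apply (T r z) x) y = cinner x (blinfun_apply (T r (cnj z)) y)}"
      using eq[OF x] by (intro closure_minimal) auto
    then show ?thesis using adjoint_dense by blast
  qed
  have "cinner (blinfun_apply (T r z) x) y = cinner x (blinfun_apply (T r (cnj z)) y)" for x y
  proof -
    have "closed {x. cinner (blinfun_apply (T r z) x) y = cinner x (blinfun_apply (T r (cnj z)) y)}"
      by (intro closed_Collect_eq cinner.continuous_on continuous_intros)
    then have "closure (Domain (op_adjoint F)) \<subseteq>
        {x. cinner (blinfun_apply (T r z) x) y = cinner x (blinfun_apply (T r (cnj z)) y)}"
      using eq' by (intro closure_minimal) auto
    then show ?thesis using adjoint_dense by blast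
  qed
  then show ?thesis by (simp add: adjoint_pair_def)
qed

text \<open>With the witness \<open>w\<close> for \<open>x\<close>, the form is that of (H_r - z) w
  against \<open>w\<close>. The part from \<open>H r\<close> is real, so the imaginary part is Im z
  times the squared norm of \<open>w\<close>; density does the rest.\<close>

lemma Im_T_nonneg:
  assumes z: "Im z > 0"
  shows "0 \<le> Im (cinner x (blinfun_apply (T r z) x))"
proof -
  have "0 \<le> Im (cinner x (blinfun_apply (T r z) x))" if x: "x \<in> Domain (op_adjoint F)" for x
  proof -
    have z': "Im z \<noteq> 0" using z by simp
    obtain f w h v g where *: "(x, f) \<in> op_adjoint F" "(w, h) \<in> H0" "(w, v) \<in> V" "(w, g) \<in> F"
      "f = h + r *\<^sub>R v - z *\<^sub>C w"
      using sandwich_witness[OF z' x, of r] by metis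
    have "cinner x g = cinner f w"
      using *(1,4) by (metis cinner_commute op_adjoint_iff)
    also have "\<dots> = cinner (h + r *\<^sub>R v) w - cnj z * cinner w w"
      by (simp add: *(5) cinner.diff_left cinner_scaleC_left)
    finally have "cinner x g = cinner (h + r *\<^sub>R v) w - cnj z * cinner w w" .
    moreover have "Im (cinner (h + r *\<^sub>R v) w) = 0"
      using arg_cong[OF H_symmetric[OF *(2,3) *(2,3), of r], of Im]
        arg_cong[OF cinner_commute[of w "h + r *\<^sub>R v"], of Im] by simp
    ultimately show ?thesis using z by (simp add: T_apply[OF z' *] cinner_self)
  qed
  then have "Domain (op_adjoint F) \<subseteq> {x. 0 \<le> Im (cinner x (blinfun_apply (T r z) x))}" by blast
  moreover have "closed {x. 0 \<le> Im (cinner x (blinfun_apply (T r z) x))}"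
    by (intro closed_Collect_le continuous_on_Im cinner.continuous_on continuous_intros)
  ultimately have "closure (Domain (op_adjoint F)) \<subseteq>
      {x. 0 \<le> Im (cinner x (blinfun_apply (T r z) x))}"
    by (intro closure_minimal)
  then show ?thesis using adjoint_dense by blast
qed

end

text \<open>The Cauchy criterion along a filter: it yields norm limits at points where no candidate
  for the limit is known beforehand.\<close>

lemma convergent_of_dist_bound:
  fixes g :: "'c \<Rightarrow> 'd::complete_space"
  assumes "(e \<longlongrightarrow> 0) Fl" "Fl \<noteq> bot" "eventually P Fl"
    and "\<And>y y'. P y \<Longrightarrow> P y' \<Longrightarrow> dist (g y) (g y') \<le> e y + e y'"
  shows "\<exists>l. (g \<longlongrightarrow> l) Fl"
proof -
  have "cauchy_filter (filtermap g Fl)"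
    unfolding cauchy_filter_metric_filtermap
  proof (intro allI impI)
    fix d :: real assume "d > 0"
    then have "\<forall>\<^sub>F y in Fl. e y < d / 2" by (intro order_tendstoD[OF assms(1)]) simp
    then have "\<forall>\<^sub>F y in Fl. e y < d / 2 \<and> P y" using assms(3) by (rule eventually_conj)
    moreover have "dist (g x) (g y) < d" if "e x < d / 2 \<and> P x" "e y < d / 2 \<and> P y" for x y
      using that assms(4)[of x y] by linarith
    ultimately show "\<exists>P. eventually P Fl \<and> (\<forall>x y. P x \<and> P y \<longrightarrow> dist (g x) (g y) < d)"
      by blast
  qed
  then have "\<exists>l. filtermap g Fl \<le> nhds l"
    by (rule cauchy_filter_complete_converges[OF _ complete_UNIV])
      (use assms(2) in \<open>simp_all add: filtermap_bot_iff\<close>)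
  then show ?thesis by (simp add: filterlim_def)
qed

section \<open>Boundary values on the real axis and stability of non-resonance\<close>

context operator_line
begin

abbreviation B :: "real \<Rightarrow> real \<Rightarrow> real \<Rightarrow> 'k \<Rightarrow>\<^sub>L 'k" where
  "B lam s \<sigma> \<equiv> boundary_resolvent F (H s) lam \<sigma>"

lemma boundary_tendsto:
  assumes "non_resonant H0 V F lam s" "\<sigma> \<in> {1, -1}"
  shows "((\<lambda>y. T s (Complex lam (\<sigma> * y))) \<longlongrightarrow> B lam s \<sigma>) (at_right 0)"
proof -
  obtain L where L: "((\<lambda>y. T s (Complex lam (\<sigma> * y))) \<longlongrightarrow> L) (at_right 0)"
    using assms unfolding non_resonant_def regular_points_def by blast
  then have "B lam s \<sigma> = L"
    unfolding boundary_resolvent_def by (intro tendsto_Lim) simp_all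
  then show ?thesis using L by simp
qed

lemma eventually_nonreal:
  assumes "\<sigma> \<in> {1, -1::real}"
  shows "\<forall>\<^sub>F y in at_right 0. Im (Complex lam (\<sigma> * y)) \<noteq> 0"
  using eventually_at_right_less[of 0] by eventually_elim (use assms in auto)

lemma complex_linear_B:
  assumes "non_resonant H0 V F lam s" "\<sigma> \<in> {1, -1}"
  shows "complex_linear (B lam s \<sigma>)"
proof (rule complex_linear_tendsto[OF _ boundary_tendsto[OF assms]])
  show "\<forall>\<^sub>F y in at_right 0. complex_linear (T s (Complex lam (\<sigma> * y)))"
    using eventually_nonreal[OF assms(2)] by eventually_elim (rule complex_linear_T)
qed simp

lemma adjoint_pair_B:
  assumes "non_resonant H0 V F lam s" "\<sigma> \<in> {1, -1}"
  shows "adjoint_pair (B lam s \<sigma>) (B lam s (- \<sigma>))"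
proof (rule adjoint_pair_tendsto[OF _ boundary_tendsto[OF assms] boundary_tendsto[OF assms(1)]])
  show "\<forall>\<^sub>F y in at_right 0.
      adjoint_pair (T s (Complex lam (\<sigma> * y))) (T s (Complex lam (- \<sigma> * y)))"
  proof (rule eventually_mono[OF eventually_nonreal[OF assms(2)]])
    fix y assume y: "Im (Complex lam (\<sigma> * y)) \<noteq> 0"
    have "cnj (Complex lam (\<sigma> * y)) = Complex lam (- \<sigma> * y)" by (simp add: complex_eq_iff)
    then show "adjoint_pair (T s (Complex lam (\<sigma> * y))) (T s (Complex lam (- \<sigma> * y)))"
      using adjoint_pair_T[OF y, of s] by metis
  qed
qed (use assms in auto)

lemma Im_B_nonneg:
  assumes "non_resonant H0 V F lam s"
  shows "0 \<le> Im (cinner x (blinfun_apply (B lam s 1) x))"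
proof (rule tendsto_lowerbound)
  show "((\<lambda>y. Im (cinner x (blinfun_apply (T s (Complex lam (1 * y))) x))) \<longlongrightarrow>
      Im (cinner x (blinfun_apply (B lam s 1) x))) (at_right 0)"
    using assms
    by (intro tendsto_Im cinner.tendsto blinfun.tendsto tendsto_const boundary_tendsto) auto
  show "\<forall>\<^sub>F y in at_right 0. 0 \<le> Im (cinner x (blinfun_apply (T s (Complex lam (1 * y))) x))"
    using eventually_at_right_less[of 0] by eventually_elim (intro Im_T_nonneg, simp)
qed simp

lemma boundary_identity:
  assumes "non_resonant H0 V F lam s" "non_resonant H0 V F lam r" "\<sigma> \<in> {1, -1}"
  shows "B lam r \<sigma> = B lam s \<sigma> + (s - r) *\<^sub>R (B lam s \<sigma> o\<^sub>L J o\<^sub>L B lam r \<sigma>)"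
proof -
  let ?z = "\<lambda>y. Complex lam (\<sigma> * y)"
  have "((\<lambda>y. T s (?z y) + (s - r) *\<^sub>R (T s (?z y) o\<^sub>L J o\<^sub>L T r (?z y))) \<longlongrightarrow>
      B lam s \<sigma> + (s - r) *\<^sub>R (B lam s \<sigma> o\<^sub>L J o\<^sub>L B lam r \<sigma>)) (at_right 0)"
    by (intro tendsto_intros bounded_bilinear.tendsto[OF bounded_bilinear_blinfun_compose]
        boundary_tendsto assms)
  moreover have "\<forall>\<^sub>F y in at_right 0.
      T s (?z y) + (s - r) *\<^sub>R (T s (?z y) o\<^sub>L J o\<^sub>L T r (?z y)) = T r (?z y)"
    using eventually_nonreal[OF assms(3)]
    by eventually_elim (rule resolvent_identity[symmetric])
  ultimately have "((\<lambda>y. T r (?z y)) \<longlongrightarrow>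
      B lam s \<sigma> + (s - r) *\<^sub>R (B lam s \<sigma> o\<^sub>L J o\<^sub>L B lam r \<sigma>)) (at_right 0)"
    by (rule Lim_transform_eventually)
  with boundary_tendsto[OF assms(2,3)] show ?thesis
    by (rule tendsto_unique[rotated]) simp
qed

text \<open>The second sign needs no separate bound: the resolvents at conjugate points are adjoint to
  each other, so their differences have the same norm.\<close>

lemma non_resonantI:
  assumes s: "non_resonant H0 V F lam s" and \<sigma>: "\<sigma> \<in> {1, -1}" and c: "c > 0"
    and below: "\<And>x. c * norm x \<le> norm (x + (t - s) *\<^sub>R blinfun_apply (B lam s \<sigma>) (blinfun_apply J x))"
  shows "non_resonant H0 V F lam t"
proof -
  define z where "z \<tau> y = Complex lam (\<tau> * y)" for \<tau> y :: real
  define L where "L = B lam s \<sigma>"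
  define f where "f y = T s (z \<sigma> y)" for y
  define g where "g y = T t (z \<sigma> y)" for y
  define d where "d = \<bar>t - s\<bar> * norm J"
  define e where "e y = norm (f y - L)" for y
  define K where "K = 2 / c * (norm L + 1)"
  define P where "P y \<longleftrightarrow> y > 0 \<and> d * e y < c / 2 \<and> e y < 1" for y
  have d0: "d \<ge> 0" and K0: "K \<ge> 0" and e0: "e y \<ge> 0" for y
    using c by (auto simp: d_def K_def e_def)
  have "(f \<longlongrightarrow> L) (at_right 0)"
    unfolding f_def L_def z_def by (rule boundary_tendsto[OF s \<sigma>])
  then have e: "(e \<longlongrightarrow> 0) (at_right 0)"
    unfolding e_def by (intro tendsto_norm_zero) (simp add: LIM_zero_iff)
  have "((\<lambda>y. d * e y) \<longlongrightarrow> d * 0) (at_right 0)" by (intro tendsto_intros e)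
  then have "\<forall>\<^sub>F y in at_right 0. d * e y < c / 2"
    using c by (intro order_tendstoD) auto
  moreover have "\<forall>\<^sub>F y in at_right 0. e y < 1" by (intro order_tendstoD(2)[OF e]) simp
  ultimately have P: "eventually P (at_right 0)"
    unfolding P_def using eventually_at_right_less[of 0] by eventually_elim simp
  have z: "Im (z \<sigma> y) \<noteq> 0" if "P y" for y using that \<sigma> by (auto simp: P_def z_def)
  \<comment> \<open>In the resolvent identity \<open>f y\<close> is replaced by its limit
    \<open>L\<close> on the left, so that the operator bounded below by \<open>c\<close> acts on
    \<open>g y\<close>; the error is governed by \<open>f y - L\<close>.\<close>
  have ident: "blinfun_apply (g y) x + (t - s) *\<^sub>R blinfun_apply L (blinfun_apply J (blinfun_apply (g y) x)) =
      blinfun_apply (f y) x -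
      (t - s) *\<^sub>R blinfun_apply (f y - L) (blinfun_apply J (blinfun_apply (g y) x))"
    if y: "P y" for x y
    using arg_cong[OF resolvent_identity[OF z[OF y], of t s], of "\<lambda>A. blinfun_apply A x"]
    by (simp add: f_def g_def blinfun.add_left blinfun.diff_left blinfun.scaleR_left algebra_simps)
  have dbound: "norm ((t - s) *\<^sub>R blinfun_apply (f y - L) (blinfun_apply J x)) \<le> d * e y * norm x" for x y
  proof -
    have "norm (blinfun_apply (f y - L) (blinfun_apply J x)) \<le> e y * norm (blinfun_apply J x)"
      unfolding e_def by (rule norm_blinfun)
    also have "\<dots> \<le> e y * (norm J * norm x)" by (intro mult_left_mono norm_blinfun e0)
    finally have "\<bar>t - s\<bar> * norm (blinfun_apply (f y - L) (blinfun_apply J x)) \<le>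
        \<bar>t - s\<bar> * (e y * (norm J * norm x))" by (rule mult_left_mono) simp
    then show ?thesis by (simp add: d_def mult_ac)
  qed
  \<comment> \<open>\<open>P\<close> keeps the error below c/2 times the norm on the left, where it
    is absorbed; the remaining c/2 is the origin of the factor 2 / c in \<open>K\<close>. The Cauchy
    estimate relies on this uniform bound.\<close>
  have gK: "norm (blinfun_apply (g y) x) \<le> K * norm x" if y: "P y" for x y
  proof -
    let ?n = "norm (blinfun_apply (g y) x)"
    have "c * ?n \<le> norm (blinfun_apply (f y) x) + d * e y * ?n"
      using below[of "blinfun_apply (g y) x", folded L_def] dbound[of y "blinfun_apply (g y) x"]
        norm_triangle_ineq4[of "blinfun_apply (f y) x"
          "(t - s) *\<^sub>R blinfun_apply (f y - L) (blinfun_apply J (blinfun_apply (g y) x))"]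
      unfolding ident[OF y] by linarith
    moreover have "d * e y * ?n \<le> c / 2 * ?n"
      using y by (intro mult_right_mono) (auto simp: P_def)
    moreover have "norm (blinfun_apply (f y) x) \<le> (norm L + 1) * norm x"
    proof -
      have "norm (f y) \<le> norm L + 1"
        using y norm_triangle_ineq[of L "f y - L"] by (simp add: P_def e_def)
      then show ?thesis
        using norm_blinfun[of "f y" x] mult_right_mono[of "norm (f y)" "norm L + 1" "norm x"]
        by simp
    qed
    ultimately have "c / 2 * ?n \<le> (norm L + 1) * norm x" by linarith
    then show ?thesis using c by (simp add: K_def field_simps)
  qed
  \<comment> \<open>Two instances of \<open>ident\<close> are subtracted, and the lower bound is
    applied to the difference of \<open>g y\<close> and \<open>g y'\<close>.\<close>
  have dist: "dist (g y) (g y') \<le> (1 + d * K) / c * e y + (1 + d * K) / c * e y'"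
    if y: "P y" and y': "P y'" for y y'
    unfolding dist_norm
  proof (rule norm_blinfun_bound)
    show "0 \<le> (1 + d * K) / c * e y + (1 + d * K) / c * e y'"
      using c d0 K0 e0 by simp
    fix x
    let ?h = "\<lambda>y. (t - s) *\<^sub>R blinfun_apply (f y - L) (blinfun_apply J (blinfun_apply (g y) x))"
    let ?w = "blinfun_apply (g y - g y') x"
    let ?k = "\<lambda>y. blinfun_apply (g y) x +
        (t - s) *\<^sub>R blinfun_apply L (blinfun_apply J (blinfun_apply (g y) x))"
    have "?w + (t - s) *\<^sub>R blinfun_apply L (blinfun_apply J ?w) = ?k y - ?k y'"
      by (simp add: blinfun.diff_left blinfun.diff_right algebra_simps)
    also have "\<dots> = blinfun_apply (f y - L) x - blinfun_apply (f y' - L) x - ?h y + ?h y'"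
      unfolding ident[OF y] ident[OF y'] by (simp add: blinfun.diff_left)
    finally have "c * norm ?w \<le> norm (blinfun_apply (f y - L) x - blinfun_apply (f y' - L) x - ?h y + ?h y')"
      using below[of ?w, folded L_def] by metis
    also have "\<dots> \<le> norm (blinfun_apply (f y - L) x) + norm (blinfun_apply (f y' - L) x)
        + norm (?h y) + norm (?h y')"
      by (smt (verit, best) norm_triangle_ineq norm_triangle_ineq4)
    also have "\<dots> \<le> e y * norm x + e y' * norm x + d * e y * (K * norm x) + d * e y' * (K * norm x)"
    proof (intro add_mono)
      show "norm (?h y) \<le> d * e y * (K * norm x)"
        using d0 e0 by (intro order_trans[OF dbound] mult_left_mono gK[OF y]) simp
      show "norm (?h y') \<le> d * e y' * (K * norm x)"
        using d0 e0 by (intro order_trans[OF dbound] mult_left_mono gK[OF y']) simp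
    qed (simp_all add: e_def norm_blinfun)
    also have "\<dots> = (1 + d * K) * (e y + e y') * norm x" by (simp add: algebra_simps)
    finally have "norm ?w \<le> (1 + d * K) * (e y + e y') * norm x / c"
      using c by (simp only: pos_le_divide_eq mult.commute)
    then show "norm ?w \<le> ((1 + d * K) / c * e y + (1 + d * K) / c * e y') * norm x"
      by (simp add: algebra_simps add_divide_distrib)
  qed
  have "((\<lambda>y. (1 + d * K) / c * e y) \<longlongrightarrow> (1 + d * K) / c * 0) (at_right 0)"
    by (intro tendsto_intros e)
  then have lim0: "((\<lambda>y. (1 + d * K) / c * e y) \<longlongrightarrow> 0) (at_right 0)" by simp
  have g1: "\<exists>l. (g \<longlongrightarrow> l) (at_right 0)"
    by (rule convergent_of_dist_bound[OF lim0 _ P dist]) simp_all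
  have "\<exists>l. ((\<lambda>y. T t (z (- \<sigma>) y)) \<longlongrightarrow> l) (at_right 0)"
  proof (rule convergent_of_dist_bound[OF lim0 _ P])
    fix y y' assume y: "P y" "P y'"
    have cnj: "cnj (z \<sigma> y) = z (- \<sigma>) y" for y by (simp add: z_def complex_eq_iff)
    have "norm (T t (z (- \<sigma>) y) - T t (z (- \<sigma>) y')) = norm (g y - g y')"
      unfolding g_def cnj[symmetric]
      by (intro adjoint_pair_norm adjoint_pair_diff adjoint_pair_T z y)
    then show "dist (T t (z (- \<sigma>) y)) (T t (z (- \<sigma>) y')) \<le>
        (1 + d * K) / c * e y + (1 + d * K) / c * e y'"
      using dist[OF y] by (simp add: dist_norm)
  qed simp
  then show ?thesis
    using g1 \<sigma> unfolding non_resonant_def regular_points_def g_def z_def by auto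
qed

text \<open>The correction is at most half of \<open>norm x\<close>, so 1 + (t - s) B J is bounded
  below by 1/2. Non-resonance is thus an open condition, and non-resonant points accumulate at
  \<open>s\<close>, as the identity theorem requires.\<close>

lemma non_resonant_near:
  assumes s: "non_resonant H0 V F lam s" and \<sigma>: "\<sigma> \<in> {1, -1}"
    and t: "\<bar>t - s\<bar> * norm (B lam s \<sigma> o\<^sub>L J) \<le> 1 / 2"
  shows "non_resonant H0 V F lam t"
proof (rule non_resonantI[OF s \<sigma>, of "1/2"])
  fix x
  let ?v = "blinfun_apply (B lam s \<sigma>) (blinfun_apply J x)"
  have "norm ((t - s) *\<^sub>R ?v) \<le> \<bar>t - s\<bar> * (norm (B lam s \<sigma> o\<^sub>L J) * norm x)"
    using mult_left_mono[OF norm_blinfun[of "B lam s \<sigma> o\<^sub>L J" x], of "\<bar>t - s\<bar>"] by simp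
  also have "\<dots> \<le> 1 / 2 * norm x"
    using mult_right_mono[OF t, of "norm x"] by (simp add: mult_ac)
  finally show "1 / 2 * norm x \<le> norm (x + (t - s) *\<^sub>R ?v)"
    using norm_triangle_ineq4[of "x + (t - s) *\<^sub>R ?v" "(t - s) *\<^sub>R ?v"] by simp
qed simp

end

section \<open>Meromorphic operator functions\<close>

text \<open>The set \<open>U\<close> of points with a punctured neighbourhood on which
  \<open>f\<close> vanishes is open and closed. Locally, multiplication by a power of (w - p)
  reduces to the identity theorem for holomorphic functions. Punctured neighbourhoods are used
  throughout because values at singularities are arbitrary.\<close>

lemma meromorphic_identity:
  fixes f :: "complex \<Rightarrow> complex"
  assumes mer: "\<And>p. \<exists>n e g. e > 0 \<and> g holomorphic_on ball p e \<and>
      (\<forall>w \<in> ball p e - {p}. (w - p) ^ n * f w = g w)"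
    and freq: "\<exists>\<^sub>F w in at s. f w = 0"
  shows "\<forall>\<^sub>F w in at p. f w = 0"
proof -
  have loc: "\<exists>e>0. \<forall>q\<in>ball p e. (\<exists>\<^sub>F w in at q. f w = 0) \<longrightarrow> (\<forall>w\<in>ball p e - {p}. f w = 0)" for p
  proof -
    obtain n e g where e: "e > 0" and g: "g holomorphic_on ball p e"
      and fg: "\<And>w. w \<in> ball p e - {p} \<Longrightarrow> (w - p) ^ n * f w = g w"
      using mer[of p] by blast
    have "f w = 0" if q: "q \<in> ball p e" and fq: "\<exists>\<^sub>F w in at q. f w = 0"
      and w: "w \<in> ball p e - {p}" for q w
    proof -
      define Z where "Z = {w \<in> ball p e - {p}. f w = 0}"
      have ev: "\<forall>\<^sub>F w in at q. w \<in> ball p e - {p}"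
      proof (cases "q = p")
        case True
        then show ?thesis using e by (auto simp: eventually_at intro!: exI[of _ e] simp: dist_commute)
      next
        case False
        then show ?thesis using q by (intro eventually_at_in_open') auto
      qed
      have "\<exists>\<^sub>F w in at q. w \<in> Z"
        by (rule frequently_rev_mp[OF fq]) (use ev in eventually_elim, auto simp: Z_def)
      then have "q islimpt Z" by (simp add: islimpt_conv_frequently_at)
      moreover have "Z \<subseteq> ball p e" "\<And>z. z \<in> Z \<Longrightarrow> g z = 0"
        using fg by (force simp: Z_def)+
      ultimately have "g w = 0"
        using analytic_continuation[OF g open_ball connected_ball, of Z q w] q w by blast
      then show ?thesis using fg[OF w] w by simp
    qed
    then show ?thesis using e by blast
  qed
  define U where "U = {p. \<forall>\<^sub>F w in at p. f w = 0}"
  have U_of: "p \<in> U" if "e > 0" "\<forall>w\<in>ball p e - {p}. f w = 0" for p e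
    using that by (auto simp: U_def eventually_at dist_commute)
  have "open U"
    unfolding open_dist
  proof
    fix p assume "p \<in> U"
    then obtain d where d: "d > 0" "\<And>w. w \<noteq> p \<Longrightarrow> dist w p < d \<Longrightarrow> f w = 0"
      by (auto simp: U_def eventually_at)
    have "q \<in> U" if "dist q p < d" for q
    proof (cases "q = p")
      case False
      then have "\<forall>\<^sub>F w in at q. w \<in> ball p d - {p}"
        using that by (intro eventually_at_in_open') (auto simp: dist_commute)
      then show ?thesis
        unfolding U_def using d by (auto elim!: eventually_mono simp: dist_commute)
    qed (use \<open>p \<in> U\<close> in simp)
    then show "\<exists>e>0. \<forall>q. dist q p < e \<longrightarrow> q \<in> U" using d(1) by blast
  qed
  moreover have "closed U"
    unfolding closed_limpt
  proof (intro allI impI)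
    fix p assume p: "p islimpt U"
    obtain e where e: "e > 0"
      and E: "\<And>q. q \<in> ball p e \<Longrightarrow> \<exists>\<^sub>F w in at q. f w = 0 \<Longrightarrow> \<forall>w\<in>ball p e - {p}. f w = 0"
      using loc[of p] by blast
    obtain q where "q \<in> U" "q \<in> ball p e"
      using p e unfolding islimpt_approachable by (auto simp: dist_commute)
    moreover from this have "\<exists>\<^sub>F w in at q. f w = 0"
      by (intro eventually_frequently) (simp_all add: U_def)
    ultimately show "p \<in> U" using U_of[OF e] E by blast
  qed
  moreover have "s \<in> U"
    using loc[of s] freq U_of by (metis centre_in_ball)
  ultimately have "U = UNIV" using clopen[of U] by blast
  then show ?thesis by (auto simp: U_def)
qed

lemma holomorphic_at_each_component:
  assumes "holomorphic_at_each A S"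
  shows "(\<lambda>w. cinner y (blinfun_apply (A w) x)) holomorphic_on S"
  unfolding holomorphic_on_def
proof
  fix w assume "w \<in> S"
  then obtain D where D: "(A has_derivative (\<lambda>h. h *\<^sub>C D)) (at w)"
    using assms unfolding holomorphic_at_each_def by blast
  have "bounded_linear (\<lambda>T. cinner y (blinfun_apply T x))"
    by (intro bounded_linear_compose[OF cinner.bounded_linear_right blinfun.bounded_linear_left])
  from bounded_linear.has_derivative[OF this D]
  have "((\<lambda>w. cinner y (blinfun_apply (A w) x)) has_derivative
      (\<lambda>h. cinner y (blinfun_apply D x) * h)) (at w)"
    by (simp add: scaleC_blinfun.rep_eq cinner_scaleC_right mult.commute)
  then have "((\<lambda>w. cinner y (blinfun_apply (A w) x)) has_field_derivative
      cinner y (blinfun_apply D x)) (at w)"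
    by (simp add: has_field_derivative_def)
  then show "(\<lambda>w. cinner y (blinfun_apply (A w) x)) field_differentiable at w within S"
    by (meson field_differentiable_at_within field_differentiable_def)
qed

text \<open>Matrix elements reduce the claim to scalar functions. The identity theorem gives
  vanishing only on a punctured neighbourhood of \<open>w\<close>; continuity of \<open>A\<close>
  recovers the value at \<open>w\<close>. The form with two coefficients covers both commutation
  with \<i> and the resolvent identity.\<close>

lemma meromorphic_vec_identity:
  fixes A :: "complex \<Rightarrow> 'a::complex_normed_space \<Rightarrow>\<^sub>L 'b::complex_hilbert"
  assumes A: "meromorphic_vec A" and \<alpha>: "\<alpha> holomorphic_on UNIV" and \<beta>: "\<beta> holomorphic_on UNIV"
    and freq: "\<exists>\<^sub>F w in at s.
      \<alpha> w *\<^sub>C blinfun_apply (A w) x + \<beta> w *\<^sub>C blinfun_apply (A w) x' + c = 0"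
    and w: "isCont A w"
  shows "\<alpha> w *\<^sub>C blinfun_apply (A w) x + \<beta> w *\<^sub>C blinfun_apply (A w) x' + c = 0"
proof (rule cinner_ext)
  fix y
  define f where "f w = \<alpha> w * cinner y (blinfun_apply (A w) x) +
    \<beta> w * cinner y (blinfun_apply (A w) x') + cinner y c" for w
  have f: "f w = cinner y (\<alpha> w *\<^sub>C blinfun_apply (A w) x + \<beta> w *\<^sub>C blinfun_apply (A w) x' + c)" for w
    by (simp add: f_def cinner_add_right cinner_scaleC_right)
  have "\<forall>\<^sub>F v in at w. f v = 0"
  proof (rule meromorphic_identity)
    fix p
    obtain n e g where e: "e > 0" and g: "holomorphic_at_each g (ball p e)"
      and Ag: "\<And>v. v \<in> ball p e - {p} \<Longrightarrow> (v - p) ^ n *\<^sub>C A v = g v"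
      using A unfolding meromorphic_vec_def by metis
    define G where "G v = \<alpha> v * cinner y (blinfun_apply (g v) x) +
      \<beta> v * cinner y (blinfun_apply (g v) x') + (v - p) ^ n * cinner y c" for v
    have "G holomorphic_on ball p e"
      unfolding G_def
      by (intro holomorphic_intros holomorphic_at_each_component[OF g]
          holomorphic_on_subset[OF \<alpha>] holomorphic_on_subset[OF \<beta>]) auto
    moreover have "(v - p) ^ n * f v = G v" if "v \<in> ball p e - {p}" for v
      by (simp add: f_def G_def scaleC_blinfun.rep_eq cinner_scaleC_right algebra_simps
          flip: Ag[OF that])
    ultimately show "\<exists>n e g. e > 0 \<and> g holomorphic_on ball p e \<and>
        (\<forall>w \<in> ball p e - {p}. (w - p) ^ n * f w = g w)"
      using e by blast
  next
    show "\<exists>\<^sub>F w in at s. f w = 0"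
      using freq by (rule frequently_elim1) (simp add: f cinner.zero_right)
  qed
  then have "(f \<longlongrightarrow> 0) (at w)"
    by (rule tendsto_eventually)
  moreover have "(f \<longlongrightarrow> f w) (at w)"
  proof -
    have "(\<alpha> \<longlongrightarrow> \<alpha> w) (at w)" "(\<beta> \<longlongrightarrow> \<beta> w) (at w)"
      using holomorphic_on_imp_continuous_on[OF \<alpha>] holomorphic_on_imp_continuous_on[OF \<beta>]
      by (auto simp: continuous_on_def)
    with w show ?thesis
      unfolding f_def isCont_def
      by (intro tendsto_intros cinner.tendsto blinfun.tendsto)
  qed
  ultimately have "f w = 0" using tendsto_unique[of "at w" f] by simp
  then show "cinner y (\<alpha> w *\<^sub>C blinfun_apply (A w) x + \<beta> w *\<^sub>C blinfun_apply (A w) x' + c) =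
      cinner y 0"
    by (simp add: f cinner.zero_right)
qed

section \<open>Residues of finite Laurent expansions\<close>

lemma circle_integral_power:
  fixes z :: complex
  assumes "\<rho> > 0"
  shows "((\<lambda>w. 1 / (w - z) ^ j) has_contour_integral (if j = 1 then 2 * pi * \<i> else 0))
    (circlepath z \<rho>)"
proof (cases j)
  case 0
  have "((\<lambda>w. 1) has_contour_integral 0) (circlepath z \<rho>)"
    by (rule Cauchy_theorem_convex_simple[of _ UNIV]) auto
  then show ?thesis using 0 by simp
next
  case (Suc m)
  have "((\<lambda>w. 1 / (w - z) ^ Suc m) has_contour_integral
      (2 * pi * \<i>) / fact m * (deriv ^^ m) (\<lambda>_. 1) z) (circlepath z \<rho>)"
    by (rule Cauchy_has_contour_integral_higher_derivative_circlepath) (use assms in auto)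
  then show ?thesis using Suc by (auto simp: higher_deriv_const)
qed

text \<open>The factor (w - z) shifts every exponent by one, so the residue is the coefficient of
  the double pole, \<open>n 1\<close>. Evaluation at \<open>v\<close> is bounded linear and commutes
  with the integral; an expansion on this single vector is therefore enough.\<close>

lemma contour_integral_vec_expansion:
  fixes A :: "complex \<Rightarrow> 'b::complex_hilbert \<Rightarrow>\<^sub>L 'b"
  assumes \<rho>: "\<rho> > 0" and cont: "continuous_on (sphere z \<rho>) A"
    and A: "\<And>w. w \<in> sphere z \<rho> \<Longrightarrow>
      blinfun_apply (A w) v = (\<Sum>j<k. (1 / (w - z) ^ Suc j) *\<^sub>C n j)"
    and k: "1 < k"
  shows "blinfun_apply (contour_integral_vec (circlepath z \<rho>) (\<lambda>w. (w - z) *\<^sub>C A w)) v =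
    (2 * pi * \<i>) *\<^sub>C n 1"
proof -
  define \<gamma> where "\<gamma> = circlepath z \<rho>"
  define \<gamma>' where "\<gamma>' t = vector_derivative \<gamma> (at t within {0..1})" for t
  have sphere: "\<gamma> t \<in> sphere z \<rho>" if "t \<in> {0..1}" for t
    using that \<rho> path_image_circlepath_nonneg[of \<rho> z] by (auto simp: \<gamma>_def path_image_def)
  have \<gamma>'_eq: "\<gamma>' t = 2 * pi * \<i> * \<rho> * exp (2 * of_real pi * \<i> * t)" if "t \<in> {0..1}" for t
    using vector_derivative_circlepath01[of t z \<rho>] that by (simp add: \<gamma>'_def \<gamma>_def)
  have "continuous_on {0..1} \<gamma>"
    using path_circlepath[of z \<rho>] by (simp add: \<gamma>_def path_def)
  moreover have "continuous_on {0..1} (\<lambda>t. A (\<gamma> t))"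
    by (rule continuous_on_compose2[OF cont calculation]) (use sphere in auto)
  moreover have "continuous_on {0..1} \<gamma>'"
    by (rule continuous_on_eq[of _ "\<lambda>t. 2 * pi * \<i> * \<rho> * exp (2 * of_real pi * \<i> * of_real t)"])
      (auto simp: \<gamma>'_eq intro!: continuous_intros)
  ultimately have "continuous_on {0..1} (\<lambda>t. \<gamma>' t *\<^sub>C (\<gamma> t - z) *\<^sub>C A (\<gamma> t))"
    by (intro scaleC.continuous_on continuous_intros)
  then have "(\<lambda>t. \<gamma>' t *\<^sub>C (\<gamma> t - z) *\<^sub>C A (\<gamma> t)) integrable_on {0..1}"
    by (rule integrable_continuous_interval)
  from has_integral_linear[OF integrable_integral[OF this] blinfun.bounded_linear_left[of v]]
  have "((\<lambda>t. \<gamma>' t *\<^sub>C (\<gamma> t - z) *\<^sub>C blinfun_apply (A (\<gamma> t)) v) has_integral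
      blinfun_apply (contour_integral_vec \<gamma> (\<lambda>w. (w - z) *\<^sub>C A w)) v) {0..1}"
    by (simp add: o_def scaleC_blinfun.rep_eq contour_integral_vec_def \<gamma>'_def)
  moreover have "((\<lambda>t. \<gamma>' t *\<^sub>C (\<gamma> t - z) *\<^sub>C blinfun_apply (A (\<gamma> t)) v) has_integral
      (2 * pi * \<i>) *\<^sub>C n 1) {0..1}"
  proof (rule has_integral_eq)
    fix t :: real assume t: "t \<in> {0..1}"
    have nz: "\<gamma> t - z \<noteq> 0" using sphere[OF t] \<rho> by (auto simp: dist_norm)
    show "(\<Sum>j<k. (1 / (\<gamma> t - z) ^ j * \<gamma>' t) *\<^sub>C n j) =
        \<gamma>' t *\<^sub>C (\<gamma> t - z) *\<^sub>C blinfun_apply (A (\<gamma> t)) v"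
      unfolding A[OF sphere[OF t]] scaleC.sum_right scaleC_scaleC
      using nz by (intro sum.cong) (simp_all add: divide_simps mult_ac)
  next
    have "((\<lambda>t. (1 / (\<gamma> t - z) ^ j * \<gamma>' t) *\<^sub>C n j) has_integral
        (if j = 1 then (2 * pi * \<i>) *\<^sub>C n 1 else 0)) {0..1}" for j
      using has_integral_linear[OF circle_integral_power[OF \<rho>, of z j, unfolded has_contour_integral_def]
          scaleC.bounded_linear_left[of "n j"]]
      by (auto simp: o_def \<gamma>_def \<gamma>'_def)
    then have "((\<lambda>t. \<Sum>j<k. (1 / (\<gamma> t - z) ^ j * \<gamma>' t) *\<^sub>C n j) has_integral
        (\<Sum>j<k. if j = 1 then (2 * pi * \<i>) *\<^sub>C n 1 else 0)) {0..1}"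
      by (intro has_integral_sum) auto
    then show "((\<lambda>t. \<Sum>j<k. (1 / (\<gamma> t - z) ^ j * \<gamma>' t) *\<^sub>C n j) has_integral
        (2 * pi * \<i>) *\<^sub>C n 1) {0..1}"
      using k by (simp add: sum.delta)
  qed
  ultimately show ?thesis unfolding \<gamma>_def by (rule has_integral_unique)
qed

section \<open>Nilpotent expansions\<close>

lemma linear_funpow: "linear (f :: 'c::real_vector \<Rightarrow> 'c) \<Longrightarrow> linear (f ^^ n)"
  by (induction n) (auto intro: linear_compose linear_id[unfolded id_def] simp: id_def)

text \<open>The operator d (M + M^2 + ...) contains a factor \<open>M\<close> and commutes with
  \<open>M\<close>, hence lowers by one the power of \<open>M\<close> that annihilates a
  vector.\<close>

lemma nilpotent_step:
  fixes M :: "'c::real_vector \<Rightarrow> 'c"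
  assumes "linear M" "(M ^^ Suc m) x = 0"
  shows "(M ^^ m) (d *\<^sub>R (\<Sum>i<k. (M ^^ Suc i) x)) = 0"
proof -
  have "(M ^^ m) ((M ^^ Suc i) x) = 0" for i
  proof -
    have "(M ^^ m) ((M ^^ Suc i) x) = (M ^^ (m + Suc i)) x" by (simp only: funpow_add o_apply)
    also have "m + Suc i = i + Suc m" by simp
    also have "(M ^^ (i + Suc m)) x = (M ^^ i) ((M ^^ Suc m) x)" by (simp only: funpow_add o_apply)
    also have "\<dots> = 0" by (simp only: assms(2) linear_0[OF linear_funpow[OF assms(1)]])
    finally show ?thesis .
  qed
  then show ?thesis
    by (simp only: linear_scale[OF linear_funpow[OF assms(1)]]
        linear_sum[OF linear_funpow[OF assms(1)]] sum.neutral_const scaleR_zero_right)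
qed

lemma nilpotent_power:
  fixes M :: "'c::real_vector \<Rightarrow> 'c"
  assumes "linear M" "(M ^^ k) v = 0" "j \<le> k"
  shows "(M ^^ (k - j)) (((\<lambda>x. d *\<^sub>R (\<Sum>i<k'. (M ^^ Suc i) x)) ^^ j) v) = 0"
  using assms(3)
proof (induction j)
  case 0
  then show ?case using assms(2) by simp
next
  case (Suc j)
  then have "(M ^^ Suc (k - Suc j)) (((\<lambda>x. d *\<^sub>R (\<Sum>i<k'. (M ^^ Suc i) x)) ^^ j) v) = 0"
    by (simp only: Suc_diff_Suc Suc_leD less_eq_Suc_le[symmetric])
  from nilpotent_step[OF assms(1) this, of d k'] show ?case by (simp only: funpow.simps o_apply)
qed

lemma funpow_zero_mono:
  fixes M :: "'c::real_vector \<Rightarrow> 'c"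
  assumes "linear M" "(M ^^ m) x = 0" "m \<le> k"
  shows "(M ^^ k) x = 0"
proof -
  have "(M ^^ k) x = (M ^^ (k - m)) ((M ^^ m) x)"
    using assms(3) by (simp flip: funpow_add o_apply[of "M ^^ (k - m)"])
  then show ?thesis by (simp add: assms(2) linear_0[OF linear_funpow[OF assms(1)]])
qed

text \<open>On the kernel of \<open>M ^^ k\<close> the partial geometric sum thus gives a preimage
  under 1 - M.\<close>

lemma geometric_telescope:
  fixes M :: "'c::real_vector \<Rightarrow> 'c"
  assumes "linear M"
  shows "(\<Sum>i<k. (M ^^ i) x) - M (\<Sum>i<k. (M ^^ i) x) = x - (M ^^ k) x"
  using sum_lessThan_telescope'[of "\<lambda>i. (M ^^ i) x" k]
  by (simp add: linear_sum[OF assms] sum_subtractf)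

text \<open>A finite Neumann series: for \<open>n j\<close> the j-th iterate of \<open>N\<close>,
  the hypothesis \<open>step\<close> says that \<open>X\<close> inverts h - N along the orbit.
  Solving for \<open>X (n j)\<close> in terms of \<open>X (n (Suc j))\<close> and iterating stops at
  \<open>n k = 0\<close>.\<close>

lemma resolvent_expansion:
  assumes X: "complex_linear X" and h: "h \<noteq> 0"
    and step: "\<And>j. blinfun_apply X (h *\<^sub>C n j - n (Suc j)) = n j" and k: "n k = 0"
  shows "blinfun_apply X (n 0) = (\<Sum>j<k. (1 / h ^ Suc j) *\<^sub>C n j)"
proof -
  have 1: "blinfun_apply X (n j) = (1 / h) *\<^sub>C (n j + blinfun_apply X (n (Suc j)))" for j
  proof -
    have "n j + blinfun_apply X (n (Suc j)) = h *\<^sub>C blinfun_apply X (n j)"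
      using step[of j] X by (simp add: blinfun.diff_right complex_linear_def algebra_simps)
    then show ?thesis using h by (simp add: scaleC_scaleC)
  qed
  have "blinfun_apply X (n 0) =
      (\<Sum>j<m. (1 / h ^ Suc j) *\<^sub>C n j) + (1 / h ^ m) *\<^sub>C blinfun_apply X (n m)" for m
  proof (induction m)
    case (Suc m)
    have "(1 / h ^ m) *\<^sub>C blinfun_apply X (n m) =
        (1 / h ^ Suc m) *\<^sub>C n m + (1 / h ^ Suc m) *\<^sub>C blinfun_apply X (n (Suc m))"
      by (subst 1) (simp add: scaleC_scaleC scaleC_add_right mult.commute)
    with Suc show ?case by (simp add: add.assoc)
  qed simp
  from this[of k] show ?thesis by (simp add: k blinfun.zero_right)
qed

text \<open>Once the coefficients below \<open>i\<close> vanish, h^i factors out of the sum.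
  Division of the bound by h^(2i) leaves a positive power of \<open>h\<close> on the right, so the
  limit at 0 forces \<open>c i = 0\<close>.\<close>

lemma lower_coefficients_vanish:
  fixes c :: "nat \<Rightarrow> 'c::real_normed_vector"
  assumes "e > 0"
    and bound: "\<And>h. 0 < h \<Longrightarrow> h < e \<Longrightarrow> (norm (\<Sum>i<k. h ^ i *\<^sub>R c i))\<^sup>2 \<le> K * h ^ k"
  shows "2 * i < k \<Longrightarrow> c i = 0"
proof (induction i rule: less_induct)
  case (less i)
  define q where "q h = (\<Sum>m<k - i. h ^ m *\<^sub>R c (i + m))" for h :: real
  have split: "(\<Sum>i<k. h ^ i *\<^sub>R c i) = h ^ i *\<^sub>R q h" for h
  proof -
    have "(\<Sum>i<k. h ^ i *\<^sub>R c i) = (\<Sum>j\<in>{i..<k}. h ^ j *\<^sub>R c j)"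
      using less by (intro sum.mono_neutral_right) auto
    also have "\<dots> = (\<Sum>m<k - i. h ^ (i + m) *\<^sub>R c (i + m))"
      using less.prems
      by (intro sum.reindex_bij_witness[of _ "\<lambda>m. i + m" "\<lambda>j. j - i"]) auto
    finally show ?thesis by (simp add: q_def scaleR_sum_right power_add)
  qed
  have "(q \<longlongrightarrow> q 0) (at_right 0)"
    unfolding q_def by (intro tendsto_intros)
  moreover have "q 0 = c i"
  proof -
    have "q 0 = (\<Sum>m<k - i. if m = 0 then c i else 0)"
      unfolding q_def by (intro sum.cong) auto
    then show ?thesis using less.prems by (simp add: sum.delta)
  qed
  ultimately have "((\<lambda>h. (norm (q h))\<^sup>2) \<longlongrightarrow> (norm (c i))\<^sup>2) (at_right 0)"
    by (intro tendsto_intros) simp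
  moreover have "((\<lambda>h. K * h ^ (k - 2 * i)) \<longlongrightarrow> K * 0 ^ (k - 2 * i)) (at_right 0)"
    by (intro tendsto_intros)
  moreover have "\<forall>\<^sub>F h in at_right 0. (norm (q h))\<^sup>2 \<le> K * h ^ (k - 2 * i)"
  proof -
    have "\<forall>\<^sub>F h in at_right 0. 0 < h \<and> h < e"
      using eventually_at_right_less[of 0] eventually_at_right_real[OF \<open>e > 0\<close>]
      by eventually_elim auto
    then show ?thesis
    proof (rule eventually_mono)
      fix h assume h: "0 < h \<and> h < e"
      have "h ^ (2 * i) * (norm (q h))\<^sup>2 \<le> K * h ^ k"
        using bound[of h] h by (simp add: split power_mult_distrib flip: power_mult mult.commute[of i 2])
      also have "h ^ k = h ^ (2 * i) * h ^ (k - 2 * i)"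
        using less.prems by (simp flip: power_add)
      finally show "(norm (q h))\<^sup>2 \<le> K * h ^ (k - 2 * i)"
        using h by (simp add: mult.left_commute[of K] mult_le_cancel_left_pos)
    qed
  qed
  ultimately have "(norm (c i))\<^sup>2 \<le> K * 0 ^ (k - 2 * i)"
    by (intro tendsto_le[of "at_right (0::real)"]) simp_all
  then show ?case using less.prems by (simp add: power_0_left)
qed

section \<open>Positive square roots\<close>

lemma positive_operator_iff:
  "positive_operator S \<longleftrightarrow>
    complex_linear S \<and> adjoint_pair S S \<and> (\<forall>x. 0 \<le> inner x (blinfun_apply S x))"
proof -
  have "adjoint_pair S S" if "op_adjoint (op_graph S) = op_graph S"
  proof -
    have "(y, blinfun_apply S y) \<in> op_adjoint (op_graph S)" for y
      unfolding that by (simp add: op_graph_def)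
    then show ?thesis by (auto simp: op_adjoint_iff adjoint_pair_def op_graph_def)
  qed
  moreover have "op_adjoint (op_graph S) = op_graph S" if "adjoint_pair S S"
  proof -
    have "w = blinfun_apply S y" if "(y, w) \<in> op_adjoint (op_graph S)" for y w
    proof (rule cinner_ext)
      fix x
      have "cinner (blinfun_apply S x) y = cinner x w"
        using that by (simp add: op_adjoint_iff op_graph_def)
      then show "cinner x w = cinner x (blinfun_apply S y)"
        using \<open>adjoint_pair S S\<close> by (simp add: adjoint_pair_def)
    qed
    moreover have "(y, blinfun_apply S y) \<in> op_adjoint (op_graph S)" for y
      using that by (auto simp: op_adjoint_iff adjoint_pair_def op_graph_def)
    ultimately show ?thesis by (auto simp: op_graph_def)
  qed
  moreover have "Domain (op_graph S) = UNIV" by (auto simp: op_graph_def)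
  ultimately show ?thesis
    by (auto simp: positive_operator_def self_adjoint_def linear_operator_op_graph
        densely_defined_def Re_cinner)
qed

text \<open>\<open>A - A\<^sup>2 = A (1 - A) A + (1 - A) A (1 - A)\<close> is nonnegative.\<close>

lemma contraction_of_form_bounds:
  fixes A :: "'a::real_inner \<Rightarrow>\<^sub>L 'a"
  assumes sym: "\<And>x y. inner (blinfun_apply A x) y = inner x (blinfun_apply A y)"
    and "\<And>x. 0 \<le> inner x (blinfun_apply A x)" "\<And>x. inner x (blinfun_apply A x) \<le> inner x x"
  shows "norm A \<le> 1"
proof (rule norm_blinfun_bound)
  fix x
  define y where "y = blinfun_apply A x"
  have "inner (x - y) (blinfun_apply A (x - y)) + (inner y y - inner y (blinfun_apply A y)) =
      inner x y - inner y y"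
    using sym[of x y] by (simp add: y_def blinfun.diff_right inner_diff_left inner_diff_right)
  then have "inner y y \<le> inner x y"
    using assms(2)[of "x - y"] assms(3)[of y] by linarith
  also have "inner x y \<le> inner x x" using assms(3)[of x] by (simp add: y_def)
  finally show "norm (blinfun_apply A x) \<le> 1 * norm x"
    by (simp add: norm_eq_sqrt_inner y_def)
qed simp

text \<open>The iteration \<open>Y\<^sub>n\<^sub>+\<^sub>1 = (A + Y\<^sub>n\<^sup>2) / 2\<close> is majorized by the corresponding scalar
  iteration for \<open>A = 1\<close>, hence norm convergent; its limit \<open>Y\<close> satisfies \<open>(1 - Y)\<^sup>2 = 1 - A\<close>.\<close>

lemma positive_operator_root:
  assumes "positive_operator P"
  shows "\<exists>S. positive_operator S \<and> S o\<^sub>L S = P"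
proof -
  have P: "complex_linear P" "adjoint_pair P P" "\<And>x. 0 \<le> inner x (blinfun_apply P x)"
    using assms by (auto simp: positive_operator_iff)
  have symP: "inner (blinfun_apply P x) y = inner x (blinfun_apply P y)" for x y
    using P(2) unfolding adjoint_pair_def by (simp flip: Re_cinner)
  \<comment> \<open>This normalization makes the form of P / c lie between 0 and that of the
    identity, and hence also that of \<open>A\<close>; the summand 1 keeps \<open>c\<close> positive
    when \<open>P\<close> is zero.\<close>
  define c where "c = norm P + 1"
  have c: "c > 0" by (simp add: c_def add_nonneg_pos)
  define A where "A = id_blinfun - (1 / c) *\<^sub>R P"
  have A_apply: "blinfun_apply A x = x - (1 / c) *\<^sub>R blinfun_apply P x" for x
    by (simp add: A_def blinfun.diff_left blinfun.scaleR_left)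
  have "norm A \<le> 1"
  proof (rule contraction_of_form_bounds)
    show "inner (blinfun_apply A x) y = inner x (blinfun_apply A y)" for x y
      by (simp add: A_apply inner_diff_left inner_diff_right symP)
    show "inner x (blinfun_apply A x) \<le> inner x x" for x
      using P(3)[of x] c by (simp add: A_apply inner_diff_right)
    show "0 \<le> inner x (blinfun_apply A x)" for x
    proof -
      have "inner x (blinfun_apply P x) \<le> norm x * norm (blinfun_apply P x)"
        by (rule norm_cauchy_schwarz)
      also have "\<dots> \<le> norm x * (norm P * norm x)" by (intro mult_left_mono norm_blinfun) simp
      also have "\<dots> \<le> c * (norm x * norm x)" by (simp add: c_def algebra_simps)
      finally show ?thesis
        using c by (simp add: A_apply inner_diff_right field_simps power2_norm_eq_inner[symmetric] power2_eq_square)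
    qed
  qed
  define Y where "Y = rec_nat 0 (\<lambda>_ Y. (1/2) *\<^sub>R (A + (Y o\<^sub>L Y)))"
  have Y0: "Y 0 = 0" and YS: "Y (Suc n) = (1/2) *\<^sub>R (A + (Y n o\<^sub>L Y n))" for n
    by (simp_all add: Y_def)
  define y :: "nat \<Rightarrow> real" where "y = rec_nat 0 (\<lambda>_ y. (1 + y * y) / 2)"
  have y0: "y 0 = 0" and yS: "y (Suc n) = (1 + y n * y n) / 2" for n
    by (simp_all add: y_def)
  have y01: "0 \<le> y n \<and> y n \<le> 1" for n
    by (induction n) (auto simp: y0 yS intro: mult_le_one)
  have "y n \<le> y (Suc n)" for n
    using zero_le_power2[of "1 - y n"] by (simp add: yS power2_eq_square algebra_simps)
  then have inc: "incseq y" by (rule incseq_SucI)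
  have Yy: "norm (Y n) \<le> y n" for n
  proof (induction n)
    case (Suc n)
    have "norm (A + (Y n o\<^sub>L Y n)) \<le> 1 + y n * y n"
      using norm_triangle_ineq[of A "Y n o\<^sub>L Y n"] norm_blinfun_compose[of "Y n" "Y n"]
        mult_mono[OF Suc Suc] \<open>norm A \<le> 1\<close> y01[of n] by simp
    then show ?case by (simp add: YS yS)
  qed (simp add: Y0 y0)
  have step: "norm (Y (Suc n) - Y n) \<le> y (Suc n) - y n" for n
  proof (induction n)
    case 0
    then show ?case using \<open>norm A \<le> 1\<close> by (simp add: YS yS Y0 y0)
  next
    case (Suc n)
    let ?D = "Y (Suc n) - Y n"
    \<comment> \<open>The difference of squares is split as D Y' + Y D, which keeps the order of the
      factors.\<close>
    have "Y (Suc (Suc n)) - Y (Suc n) = (1/2) *\<^sub>R ((?D o\<^sub>L Y (Suc n)) + (Y n o\<^sub>L ?D))"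
      by (intro blinfun_eqI)
        (simp add: YS[of "Suc n"] YS[of n] blinfun.add_left blinfun.diff_left blinfun.diff_right
          blinfun.scaleR_left blinfun.add_right blinfun.scaleR_right algebra_simps)
    then have "norm (Y (Suc (Suc n)) - Y (Suc n)) = norm ((?D o\<^sub>L Y (Suc n)) + (Y n o\<^sub>L ?D)) / 2"
      by simp
    also have "\<dots> \<le> (norm ?D * norm (Y (Suc n)) + norm (Y n) * norm ?D) / 2"
      by (intro divide_right_mono order_trans[OF norm_triangle_ineq] add_mono norm_blinfun_compose) simp
    also have "\<dots> \<le> ((y (Suc n) - y n) * y (Suc n) + y n * (y (Suc n) - y n)) / 2"
      using Suc Yy y01 by (intro divide_right_mono add_mono mult_mono) (auto intro: incseq_SucD[OF inc])
    also have "\<dots> = y (Suc (Suc n)) - y (Suc n)"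
      by (simp add: yS[of "Suc n"] yS[of n] algebra_simps add_divide_distrib diff_divide_distrib)
    finally show ?case .
  qed
  have tele: "norm (Y (m + n) - Y m) \<le> y (m + n) - y m" for m n
  proof (induction n)
    case (Suc n)
    have "norm (Y (m + Suc n) - Y m) \<le> norm (Y (Suc (m + n)) - Y (m + n)) + norm (Y (m + n) - Y m)"
      using norm_triangle_ineq[of "Y (Suc (m + n)) - Y (m + n)" "Y (m + n) - Y m"] by simp
    then show ?case using Suc step[of "m + n"] by simp
  qed simp
  have dist: "dist (Y m) (Y n) \<le> dist (y m) (y n)" for m n
  proof (induction m n rule: linorder_wlog)
    case (le m n)
    then obtain p where "n = m + p" using le_Suc_ex by blast
    then show ?case using tele[of m p] by (simp add: dist_norm norm_minus_commute)
  qed (simp add: dist_commute)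
  obtain l where "y \<longlonglongrightarrow> l" using incseq_convergent[OF inc, of 1] y01 by blast
  then have "Cauchy y" by (rule LIMSEQ_imp_Cauchy)
  then have "Cauchy Y"
    unfolding Cauchy_def using dist by (meson le_less_trans)
  then obtain L where L: "Y \<longlonglongrightarrow> L" using Cauchy_convergent convergent_def by blast
  have "(\<lambda>n. Y (Suc n)) \<longlonglongrightarrow> (1/2) *\<^sub>R (A + (L o\<^sub>L L))"
    unfolding YS
    by (intro tendsto_intros bounded_bilinear.tendsto[OF bounded_bilinear_blinfun_compose] L)
  then have fixpoint: "L = (1/2) *\<^sub>R (A + (L o\<^sub>L L))"
    using LIMSEQ_unique LIMSEQ_Suc[OF L] by blast
  have "norm (Y n) \<le> 1" for n
    using Yy[of n] y01[of n] by linarith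
  then have "norm L \<le> 1"
    by (intro tendsto_upperbound[OF tendsto_norm[OF L]])
      (simp_all add: always_eventually)
  have adjA: "adjoint_pair A A"
    using P(2) unfolding adjoint_pair_def
    by (simp add: A_apply cinner.diff_left cinner.diff_right cinner_scaleR_left cinner_scaleR_right)
  have "adjoint_pair (Y n) (Y n)" for n
  proof (induction n)
    case (Suc n)
    then show ?case using adjA unfolding adjoint_pair_def
      by (simp add: YS blinfun.add_left blinfun.scaleR_left cinner_scaleR_left cinner_scaleR_right
          cinner_add_left cinner_add_right)
  qed (simp add: Y0 adjoint_pair_def cinner.zero_left cinner.zero_right)
  then have adjL: "adjoint_pair L L"
    by (intro adjoint_pair_tendsto[OF _ L L]) (auto intro!: always_eventually)
  have linA: "complex_linear A"
    using P(1) by (simp add: complex_linear_def A_apply scaleC_diff_right scaleR_scaleC_commute)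
  have "complex_linear (Y n)" for n
  proof (induction n)
    case (Suc n)
    then show ?case using linA unfolding complex_linear_def
      by (simp add: YS blinfun.add_left blinfun.scaleR_left scaleR_scaleC_commute scaleC_add_right)
  qed (simp add: Y0 complex_linear_def)
  then have linL: "complex_linear L"
    by (intro complex_linear_tendsto[OF _ L]) (auto intro!: always_eventually)
  \<comment> \<open>The fixed point equation reads (1 - L)^2 = 1 - A = P / c, whence the factor
    \<open>sqrt c\<close>. The bound \<open>norm L \<le> 1\<close> makes \<open>S\<close>
    positive.\<close>
  define S where "S = sqrt c *\<^sub>R (id_blinfun - L)"
  have S_apply: "blinfun_apply S x = sqrt c *\<^sub>R (x - blinfun_apply L x)" for x
    by (simp add: S_def blinfun.diff_left blinfun.scaleR_left)
  have "S o\<^sub>L S = P"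
  proof (rule blinfun_eqI)
    fix x
    have "2 *\<^sub>R blinfun_apply L x = blinfun_apply A x + blinfun_apply L (blinfun_apply L x)"
      using arg_cong[OF fixpoint, of "\<lambda>L. 2 *\<^sub>R blinfun_apply L x"]
      by (simp add: blinfun.scaleR_left blinfun.add_left)
    then have eq: "blinfun_apply L (blinfun_apply L x) =
        2 *\<^sub>R blinfun_apply L x - x + (1 / c) *\<^sub>R blinfun_apply P x"
      by (simp add: A_apply algebra_simps)
    have "blinfun_apply (S o\<^sub>L S) x =
        c *\<^sub>R (x - 2 *\<^sub>R blinfun_apply L x + blinfun_apply L (blinfun_apply L x))"
      using c by (simp add: S_apply blinfun.diff_right blinfun.scaleR_right scaleR_2 algebra_simps
          flip: real_sqrt_mult)
    also have "\<dots> = blinfun_apply P x" using c by (simp add: eq)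
    finally show "blinfun_apply (S o\<^sub>L S) x = blinfun_apply P x" .
  qed
  moreover have "positive_operator S"
    unfolding positive_operator_iff
  proof (intro conjI allI)
    show "complex_linear S"
      using linL by (simp add: complex_linear_def S_apply scaleC_diff_right scaleR_scaleC_commute)
    show "adjoint_pair S S"
      using adjL by (simp add: adjoint_pair_def S_apply cinner.diff_left cinner.diff_right
          cinner_scaleR_left cinner_scaleR_right)
    fix x
    have "inner x (blinfun_apply L x) \<le> norm x * norm (blinfun_apply L x)"
      by (rule norm_cauchy_schwarz)
    also have "\<dots> \<le> norm x * (norm L * norm x)" by (intro mult_left_mono norm_blinfun) simp
    also have "\<dots> \<le> norm x * (1 * norm x)"
      using \<open>norm L \<le> 1\<close> by (intro mult_left_mono mult_right_mono) simp_all
    also have "\<dots> = inner x x" by (simp add: power2_norm_eq_inner flip: power2_eq_square)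
    finally show "0 \<le> inner x (blinfun_apply S x)"
      using c by (simp add: S_apply inner_diff_right)
  qed
  ultimately show ?thesis by blast
qed

lemma op_sqrt:
  assumes "positive_operator P"
  shows "positive_operator (op_sqrt P)" "op_sqrt P o\<^sub>L op_sqrt P = P"
  using someI_ex[OF positive_operator_root[OF assms]] unfolding op_sqrt_def by auto

lemma norm_op_sqrt:
  assumes "positive_operator P"
  shows "(norm (blinfun_apply (op_sqrt P) x))\<^sup>2 = inner x (blinfun_apply P x)"
proof -
  let ?S = "op_sqrt P"
  have "cinner (blinfun_apply ?S x) (blinfun_apply ?S x) =
      cinner x (blinfun_apply (?S o\<^sub>L ?S) x)"
    using op_sqrt(1)[OF assms] by (simp add: positive_operator_iff adjoint_pair_def)
  then have "Re (cinner (blinfun_apply ?S x) (blinfun_apply ?S x)) = Re (cinner x (blinfun_apply P x))"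
    by (simp only: op_sqrt(2)[OF assms])
  then show ?thesis by (simp only: Re_cinner power2_norm_eq_inner)
qed

text \<open>The operators are real-linear by their type, so commutation with \<i> is all that is
  missing. As a single relation it can be continued analytically.\<close>

lemma complex_linearI_i:
  assumes "\<And>x. blinfun_apply T (\<i> *\<^sub>C x) = \<i> *\<^sub>C blinfun_apply T x"
  shows "complex_linear T"
  unfolding complex_linear_def
proof (intro allI)
  fix c x
  have split: "c *\<^sub>C y = Re c *\<^sub>R y + Im c *\<^sub>R \<i> *\<^sub>C y" for y :: "'c::complex_normed_space"
    by (subst complex_eq[of c])
      (simp add: scaleC_add_left scaleC_of_real scaleC_scaleC mult.commute flip: scaleC_of_real)
  show "blinfun_apply T (c *\<^sub>C x) = c *\<^sub>C blinfun_apply T x"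
    unfolding split by (simp add: blinfun.add_right blinfun.scaleR_right assms)
qed

lemma inner_op_Im:
  assumes "adjoint_pair T T'"
  shows "inner x (blinfun_apply (op_Im T) x) = Im (cinner x (blinfun_apply T x))"
proof -
  have "cinner x (blinfun_apply T' x) = cnj (cinner x (blinfun_apply T x))"
    using assms unfolding adjoint_pair_def by (metis cinner_commute)
  moreover have "cinner x (blinfun_apply (c *\<^sub>C (T - T')) x) =
      c * (cinner x (blinfun_apply T x) - cinner x (blinfun_apply T' x))" for c
    by (simp only: scaleC_blinfun.rep_eq cinner_scaleC_right blinfun.diff_left cinner.diff_right)
  ultimately have "cinner x (blinfun_apply (op_Im T) x) = of_real (Im (cinner x (blinfun_apply T x)))"
    by (simp only: op_Im_def bounded_adjoint_eq[OF assms] complex_diff_cnj)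
      (simp add: complex_eq_iff)
  then show ?thesis by (simp flip: Re_cinner)
qed

lemma positive_operator_op_Im:
  assumes T: "complex_linear T" "complex_linear T'" "adjoint_pair T T'"
    and "\<And>x. 0 \<le> Im (cinner x (blinfun_apply T x))"
  shows "positive_operator (op_Im T)"
  unfolding positive_operator_iff
proof (intro conjI allI)
  have eq: "op_Im T = (1 / (2 * \<i>)) *\<^sub>C (T - T')"
    unfolding op_Im_def bounded_adjoint_eq[OF T(3)] ..
  show "complex_linear (op_Im T)"
    using T(1,2) unfolding eq complex_linear_def
    by (simp add: scaleC_blinfun.rep_eq blinfun.diff_left scaleC_scaleC scaleC_diff_right mult.commute)
  have "cinner (blinfun_apply T' x) y = cinner x (blinfun_apply T y)" for x y
    using T(3) unfolding adjoint_pair_commute[of T] by (simp add: adjoint_pair_def)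
  then show "adjoint_pair (op_Im T) (op_Im T)"
    using T(3) unfolding eq adjoint_pair_def
    by (simp add: scaleC_blinfun.rep_eq blinfun.diff_left cinner_scaleC_left cinner_scaleC_right
        cinner.diff_left cinner.diff_right algebra_simps)
qed (simp add: inner_op_Im[OF T(3)] assms(4))

section \<open>Resonance vectors\<close>

locale resonance = operator_line H0 V F J
  for H0 V :: "('h::complex_hilbert \<times> 'h) set"
    and F :: "('h \<times> 'k::complex_hilbert) set"
    and J :: "'k \<Rightarrow>\<^sub>L 'k" +
  fixes A :: "complex \<Rightarrow> 'k \<Rightarrow>\<^sub>L 'k" and lam r \<sigma> \<rho> s :: real
  assumes resonant: "\<not> non_resonant H0 V F lam r"
    and sign: "\<sigma> \<in> {1, -1}"
    and continuation: "meromorphic_continuation H0 V F J lam \<sigma> A"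
    and radius: "\<rho> > 0"
    and holomorphic: "holomorphic_at_each A (cball (of_real r) \<rho> - {of_real r})"
    and base: "non_resonant H0 V F lam s"
begin

abbreviation D :: "complex set" where "D \<equiv> cball (of_real r) \<rho> - {of_real r}"

definition M :: "'k \<Rightarrow> 'k" where
  "M x = x + (r - s) *\<^sub>R blinfun_apply (A (of_real s)) x"

text \<open>On the kernel of \<open>M ^^ k\<close> this is (r - s) M (1 - M)^(-1), the geometric
  series being finite there. It arises from A(w)^(-1) = A(s)^(-1) + (w - s) with A(s) = (M - 1) / (r
  - s), which rewrites as (w - r) - N.\<close>

definition N :: "nat \<Rightarrow> 'k \<Rightarrow> 'k" where
  "N k x = (r - s) *\<^sub>R (\<Sum>i<k. (M ^^ Suc i) x)"

lemma linear_M: "linear M"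
  unfolding M_def
  by (intro linearI) (simp_all add: blinfun.add_right blinfun.scaleR_right algebra_simps)

lemma isCont_A: "w \<in> D \<Longrightarrow> isCont A w"
  using holomorphic unfolding holomorphic_at_each_def by (blast dest: has_derivative_continuous)

lemma A_real: "non_resonant H0 V F lam t \<Longrightarrow> A (of_real t) = B lam t \<sigma> o\<^sub>L J"
  using continuation by (simp add: meromorphic_continuation_def)

lemma complex_linear_A_real:
  assumes "non_resonant H0 V F lam t"
  shows "complex_linear (A (of_real t))"
proof -
  have "complex_linear J"
    using J_self_adjoint unfolding self_adjoint_def linear_operator_op_graph by blast
  with complex_linear_B[OF assms sign] show ?thesis
    by (simp add: A_real[OF assms] complex_linear_def)
qed

section \<open>The resolvent identity and its analytic continuation\<close>

lemma A_real_identity: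
  assumes "non_resonant H0 V F lam t" "non_resonant H0 V F lam t'"
  shows "blinfun_apply (A (of_real t')) x = blinfun_apply (A (of_real t)) x +
    (t - t') *\<^sub>R blinfun_apply (A (of_real t)) (blinfun_apply (A (of_real t')) x)"
  using arg_cong[OF boundary_identity[OF assms sign], of "\<lambda>T. blinfun_apply T (blinfun_apply J x)"]
  by (simp add: A_real assms blinfun.add_left blinfun.scaleR_left)

lemma frequently_non_resonant:
  "\<exists>\<^sub>F w in at (complex_of_real s). \<exists>t. w = of_real t \<and> non_resonant H0 V F lam t"
  unfolding frequently_at
proof (intro allI impI)
  fix d :: real assume d: "d > 0"
  define K where "K = norm (B lam s \<sigma> o\<^sub>L J)"
  \<comment> \<open>The first entry keeps the new point within distance \<open>d\<close>; the second
    makes \<open>e * K\<close> at most 1/2, as stability of non-resonance at \<open>s\<close>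
    demands. The summand 1 guards against \<open>K = 0\<close>.\<close>
  define e where "e = min (d / 2) (1 / (2 * (K + 1)))"
  have K: "K \<ge> 0" by (simp add: K_def)
  then have e: "e > 0" "e < d" using d by (auto simp: e_def)
  have "e * K \<le> e * (K + 1)" using e by (intro mult_left_mono) auto
  also have "\<dots> \<le> 1 / (2 * (K + 1)) * (K + 1)"
    using K by (intro mult_right_mono) (auto simp: e_def)
  also have "\<dots> = 1 / 2" using K by (simp add: field_simps)
  finally have "non_resonant H0 V F lam (s + e)"
    using e by (intro non_resonant_near[OF base sign]) (simp add: K_def)
  moreover have "dist (complex_of_real (s + e)) (of_real s) < d"
    using e by (simp add: dist_norm flip: of_real_diff)
  moreover have "complex_of_real (s + e) \<noteq> of_real s" using e by simp
  ultimately show "\<exists>w\<in>UNIV. w \<noteq> complex_of_real s \<and> dist w (of_real s) < d \<and>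
      (\<exists>t. w = of_real t \<and> non_resonant H0 V F lam t)"
    by blast
qed

text \<open>At non-resonant real points linearity is inherited from the resolvents. Elsewhere the
  values of the continuation are only known to be real-linear, so the relation is continued from the
  real points accumulating at \<open>s\<close>.\<close>

lemma complex_linear_A:
  assumes w: "w \<in> D"
  shows "complex_linear (A w)"
proof (rule complex_linearI_i)
  fix x
  have "1 *\<^sub>C blinfun_apply (A w) (\<i> *\<^sub>C x) + (- \<i>) *\<^sub>C blinfun_apply (A w) x + 0 = 0"
  proof (rule meromorphic_vec_identity[where s = "of_real s" and \<alpha> = "\<lambda>_. 1" and \<beta> = "\<lambda>_. - \<i>"])
    show "meromorphic_vec A" using continuation by (simp add: meromorphic_continuation_def)
    show "\<exists>\<^sub>F v in at (of_real s).
        1 *\<^sub>C blinfun_apply (A v) (\<i> *\<^sub>C x) + (- \<i>) *\<^sub>C blinfun_apply (A v) x + 0 = 0"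
      using frequently_non_resonant
    proof (rule frequently_elim1)
      fix v :: complex assume "\<exists>t. v = of_real t \<and> non_resonant H0 V F lam t"
      then show "1 *\<^sub>C blinfun_apply (A v) (\<i> *\<^sub>C x) + (- \<i>) *\<^sub>C blinfun_apply (A v) x + 0 = 0"
        using complex_linear_A_real by (auto simp: complex_linear_def)
    qed
  qed (use isCont_A[OF w] in \<open>auto intro: holomorphic_intros\<close>)
  then show "blinfun_apply (A w) (\<i> *\<^sub>C x) = \<i> *\<^sub>C blinfun_apply (A w) x" by simp
qed

text \<open>With the base point \<open>s\<close> fixed the resolvent identity is a meromorphic
  relation in the other argument alone, so it extends from real non-resonant points to the whole
  punctured disc.\<close>

lemma A_identity:
  assumes w: "w \<in> D"
  shows "blinfun_apply (A w) (x + (w - of_real s) *\<^sub>C blinfun_apply (A (of_real s)) x) =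
    blinfun_apply (A (of_real s)) x"
proof -
  let ?y = "blinfun_apply (A (of_real s)) x"
  have "1 *\<^sub>C blinfun_apply (A w) x + (w - of_real s) *\<^sub>C blinfun_apply (A w) ?y + (- ?y) = 0"
  proof (rule meromorphic_vec_identity[where s = "of_real s" and \<alpha> = "\<lambda>_. 1"
        and \<beta> = "\<lambda>w. w - of_real s"])
    show "meromorphic_vec A" using continuation by (simp add: meromorphic_continuation_def)
    show "\<exists>\<^sub>F v in at (of_real s).
        1 *\<^sub>C blinfun_apply (A v) x + (v - of_real s) *\<^sub>C blinfun_apply (A v) ?y + (- ?y) = 0"
      using frequently_non_resonant
    proof (rule frequently_elim1)
      fix v :: complex assume "\<exists>t. v = of_real t \<and> non_resonant H0 V F lam t"
      then obtain t where t: "v = of_real t" "non_resonant H0 V F lam t" by blast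
      have "(v - of_real s) *\<^sub>C blinfun_apply (A v) ?y = (t - s) *\<^sub>R blinfun_apply (A v) ?y"
        by (simp add: t flip: of_real_diff scaleC_of_real)
      then show "1 *\<^sub>C blinfun_apply (A v) x + (v - of_real s) *\<^sub>C blinfun_apply (A v) ?y + (- ?y) = 0"
        using A_real_identity[OF t(2) base, of x] by (simp add: t)
    qed
  qed (use isCont_A[OF w] in \<open>auto intro!: holomorphic_intros\<close>)
  then show ?thesis
    using complex_linear_A[OF w] by (simp add: complex_linear_def blinfun.add_right)
qed

text \<open>By the continued identity, 1 - (t - s) A(t) is a left inverse of 1 + (t - s) A(s). The
  latter is therefore bounded below, with constant the inverse of \<open>c\<close>, and this forces
  the boundary limits at \<open>t\<close> to exist.\<close>

lemma non_resonant_punctured: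
  assumes "t \<noteq> r" "\<bar>t - r\<bar> \<le> \<rho>"
  shows "non_resonant H0 V F lam t"
proof -
  have t: "complex_of_real t \<in> D"
    using assms by (auto simp: dist_norm abs_minus_commute simp flip: of_real_diff)
  define c where "c = 1 + \<bar>t - s\<bar> * norm (A (of_real t))"
  have c: "c > 0" by (simp add: c_def add_pos_nonneg)
  show ?thesis
  proof (rule non_resonantI[OF base sign, of "1 / c"])
    fix x
    let ?y = "x + (t - s) *\<^sub>R blinfun_apply (B lam s \<sigma>) (blinfun_apply J x)"
    have "blinfun_apply (A (of_real t)) ?y = blinfun_apply (A (of_real s)) x"
      using A_identity[OF t, of x] by (simp add: A_real[OF base] scaleC_of_real flip: of_real_diff)
    then have "x = ?y - (t - s) *\<^sub>R blinfun_apply (A (of_real t)) ?y"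
      by (simp add: A_real[OF base])
    then have "norm x \<le> norm ?y + norm ((t - s) *\<^sub>R blinfun_apply (A (of_real t)) ?y)"
      by (metis norm_triangle_ineq4)
    also have "\<dots> \<le> norm ?y + \<bar>t - s\<bar> * (norm (A (of_real t)) * norm ?y)"
      by (simp add: mult_left_mono norm_blinfun)
    also have "\<dots> = c * norm ?y" by (simp add: c_def algebra_simps)
    finally show "1 / c * norm x \<le> norm ?y" using c by (simp add: field_simps)
  qed (use c in simp)
qed

text \<open>Write x = (1 - M) y with \<open>y\<close> the geometric sum. Since 1 - M = -(r - s)
  A(s), the argument becomes -(r - s) (y + (w - s) A(s) y), on which \<open>A w\<close> is given by
  the continued resolvent identity.\<close>

lemma A_inverse:
  assumes w: "w \<in> D" and x: "(M ^^ k) x = 0"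
  shows "blinfun_apply (A w) ((w - of_real r) *\<^sub>C x - N k x) = x"
proof -
  define y where "y = (\<Sum>i<k. (M ^^ i) x)"
  define d where "d = r - s"
  let ?As = "blinfun_apply (A (of_real s))"
  have yM: "y - M y = x" unfolding y_def geometric_telescope[OF linear_M] x by simp
  have NM: "N k x = d *\<^sub>R M y" by (simp add: N_def y_def d_def linear_sum[OF linear_M])
  have Asy: "x = - (d *\<^sub>R ?As y)" using yM by (simp add: M_def d_def)
  have w_s: "w - of_real s = (w - of_real r) + of_real d" by (simp add: d_def)
  have eq: "(w - of_real r) *\<^sub>C x - N k x = - (d *\<^sub>R (y + (w - of_real s) *\<^sub>C ?As y))"
  proof -
    have "(w - of_real r) *\<^sub>C x = - (d *\<^sub>R (w - of_real r) *\<^sub>C ?As y)"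
      by (subst Asy) (simp add: scaleR_scaleC_commute)
    then show ?thesis
      unfolding NM w_s scaleC_add_left scaleC_of_real M_def[of y] d_def[symmetric]
      by (simp add: scaleR_add_right)
  qed
  show ?thesis
    unfolding eq blinfun.minus_right blinfun.scaleR_right A_identity[OF w] using Asy by simp
qed

lemma kernel_N_funpow:
  assumes "(M ^^ k) v = 0"
  shows "(M ^^ k) ((N k ^^ j) v) = 0" "k \<le> j \<Longrightarrow> (N k ^^ j) v = 0"
proof -
  have N: "N k = (\<lambda>x. (r - s) *\<^sub>R (\<Sum>i<k. (M ^^ Suc i) x))" by (simp add: N_def fun_eq_iff)
  have nil: "(M ^^ (k - i)) ((N k ^^ i) v) = 0" if "i \<le> k" for i
    unfolding N by (rule nilpotent_power[OF linear_M assms that])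
  have "N k 0 = 0"
    by (simp add: N linear_0[OF linear_funpow[OF linear_M]] linear_0[OF linear_M])
  then have N0: "(N k ^^ i) 0 = 0" for i by (induction i) simp_all
  have "(N k ^^ k) v = 0" using nil[of k] by simp
  then show big: "(N k ^^ j) v = 0" if "k \<le> j" for j
  proof -
    have "(N k ^^ (j - k + k)) v = 0"
      by (simp only: funpow_add o_apply \<open>(N k ^^ k) v = 0\<close> N0)
    then show ?thesis using that by simp
  qed
  show "(M ^^ k) ((N k ^^ j) v) = 0"
  proof (cases "j \<le> k")
    case True
    then show ?thesis by (intro funpow_zero_mono[OF linear_M nil]) auto
  next
    case False
    then show ?thesis using big[of j] by (simp add: linear_0[OF linear_funpow[OF linear_M]])
  qed
qed

lemma A_expansion:
  assumes w: "w \<in> D" and v: "(M ^^ k) v = 0" and m: "k \<le> m"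
  shows "blinfun_apply (A w) v = (\<Sum>j<m. (1 / (w - of_real r) ^ Suc j) *\<^sub>C (N k ^^ j) v)"
  using resolvent_expansion[OF complex_linear_A[OF w], of "w - of_real r" "\<lambda>j. (N k ^^ j) v" m]
    A_inverse[OF w kernel_N_funpow(1)[OF v]] kernel_N_funpow(2)[OF v m] w
  by simp

lemma nilpotent_eq_N:
  assumes v: "(M ^^ k) v = 0"
  shows "blinfun_apply (resonance_nilpotent A r \<rho>) v = N k v"
proof -
  have sub: "sphere (complex_of_real r) \<rho> \<subseteq> D" using radius by auto
  have "blinfun_apply (contour_integral_vec (circlepath (of_real r) \<rho>)
      (\<lambda>w. (w - of_real r) *\<^sub>C A w)) v = (2 * pi * \<i>) *\<^sub>C (N k ^^ 1) v"
  proof (rule contour_integral_vec_expansion[OF radius])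
    show "continuous_on (sphere (of_real r) \<rho>) A"
      using sub isCont_A by (intro continuous_at_imp_continuous_on) blast
    \<comment> \<open>Padding to \<open>k + 2\<close> terms, the extra ones being zero, ensures that
      the coefficient with index 1 occurs even for small \<open>k\<close>.\<close>
    show "blinfun_apply (A w) v = (\<Sum>j<k + 2. (1 / (w - of_real r) ^ Suc j) *\<^sub>C (N k ^^ j) v)"
      if "w \<in> sphere (of_real r) \<rho>" for w
      using that sub by (intro A_expansion[OF _ v]) auto
  qed simp
  then show ?thesis
    by (simp add: resonance_nilpotent_def scaleC_blinfun.rep_eq scaleC_scaleC)
qed

lemma nilpotent_funpow_eq_N:
  assumes v: "(M ^^ k) v = 0"
  shows "(blinfun_apply (resonance_nilpotent A r \<rho>) ^^ j) v = (N k ^^ j) v"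
  by (induction j) (simp_all add: nilpotent_eq_N kernel_N_funpow(1)[OF v])

section \<open>Transport of the quadratic form and vanishing of its coefficients\<close>

lemma J_symmetric: "cinner (blinfun_apply J x) y = cinner x (blinfun_apply J y)"
proof -
  have "(y, blinfun_apply J y) \<in> op_adjoint (op_graph J)"
    using J_self_adjoint by (simp add: self_adjoint_def op_graph_def)
  then show ?thesis by (simp add: op_adjoint_iff op_graph_def)
qed

text \<open>The two sides differ by a multiple of \<open>\<langle>T\<^sub>tJx, J T\<^sub>tJx\<rangle>\<close>, which is real.\<close>

lemma form_transformation:
  assumes t: "non_resonant H0 V F lam t" and t0: "non_resonant H0 V F lam t0"
    and y: "y = x + (t0 - t) *\<^sub>R blinfun_apply (A (of_real t)) x"
  shows "Im (cinner (blinfun_apply J y) (blinfun_apply (B lam t0 \<sigma>) (blinfun_apply J y))) =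
    Im (cinner (blinfun_apply J x) (blinfun_apply (A (of_real t)) x))"
proof -
  define a where "a = blinfun_apply (A (of_real t)) x"
  \<comment> \<open>This is exactly the resolvent identity between \<open>t0\<close> and
    \<open>t\<close>, and the reason for the choice of \<open>y\<close>.\<close>
  have "blinfun_apply (B lam t0 \<sigma>) (blinfun_apply J y) = a"
    using A_real_identity[OF t0 t, of x]
    by (simp add: y a_def A_real t t0 blinfun.add_right blinfun.scaleR_right)
  moreover have "Im (cinner (blinfun_apply J a) a) = 0"
    using arg_cong[OF cinner_commute[of "blinfun_apply J a" a], of Im] by (simp add: J_symmetric)
  ultimately show ?thesis
    by (simp add: y blinfun.add_right blinfun.scaleR_right cinner_add_left cinner_scaleR_left
        flip: a_def)
qed

lemma positive_operator_Im_B: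
  assumes "non_resonant H0 V F lam t"
  shows "positive_operator (op_Im (B lam t 1))"
  using complex_linear_B[OF assms] adjoint_pair_B[OF assms, of 1] Im_B_nonneg[OF assms]
  by (intro positive_operator_op_Im[of _ "B lam t (- 1)"]) auto

text \<open>The boundary values from the two sides are adjoint to each other, so their forms are
  conjugate and the imaginary parts differ only in sign. The absolute value lets both choices of
  \<open>\<sigma>\<close> share the square root at \<open>lam + i0\<close>.\<close>

lemma norm_sqrt_Im_B:
  assumes t: "non_resonant H0 V F lam t"
  shows "(norm (blinfun_apply (op_sqrt (op_Im (B lam t 1))) x))\<^sup>2 \<le>
    \<bar>Im (cinner x (blinfun_apply (B lam t \<sigma>) x))\<bar>"
proof -
  have adj: "adjoint_pair (B lam t 1) (B lam t (- 1))" using adjoint_pair_B[OF t, of 1] by simp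
  have "(norm (blinfun_apply (op_sqrt (op_Im (B lam t 1))) x))\<^sup>2 =
      Im (cinner x (blinfun_apply (B lam t 1) x))"
    by (simp add: norm_op_sqrt[OF positive_operator_Im_B[OF t]] inner_op_Im[OF adj])
  moreover have "cinner x (blinfun_apply (B lam t (- 1)) x) = cnj (cinner x (blinfun_apply (B lam t 1) x))"
    using adj unfolding adjoint_pair_def by (metis cinner_commute)
  ultimately show ?thesis using sign by auto
qed

lemma sqrt_Im_combination_vanishes:
  assumes t0: "non_resonant H0 V F lam t0" and u: "(M ^^ k) u = 0" and m: "2 * m < k"
  shows "blinfun_apply (op_sqrt (op_Im (B lam t0 1))) (blinfun_apply J
    ((r - t0) *\<^sub>R (N k ^^ (k - Suc m)) u + (N k ^^ (k - m)) u)) = 0"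
proof -
  define p where "p x = blinfun_apply (op_sqrt (op_Im (B lam t0 1))) (blinfun_apply J x)" for x
  define n where "n j = (N k ^^ j) u" for j
  \<comment> \<open>Up to sign, \<open>a j\<close> is the coefficient of h^(-1-j) in
    \<open>y\<close>: in u - h A(t) u the vector \<open>u\<close> cancels against the first term of
    the expansion.\<close>
  define a where "a j = (r - t0) *\<^sub>R n j + n (Suc j)" for j
  define K where "K = 2 * norm (blinfun_apply J u) * (\<Sum>j<k. norm (n j))"
  have p: "linear p"
    unfolding p_def by (intro linearI) (simp_all add: blinfun.add_right blinfun.scaleR_right)
  \<comment> \<open>Multiplication by h^k turns the Laurent polynomial into a polynomial. The index
    is reversed, i = k - 1 - j, so that the highest poles become the lowest coefficients. The bound
    on \<open>h\<close> by \<open>\<rho>\<close> keeps \<open>t\<close> in the disc, that by 1 keeps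
    the powers of \<open>h\<close> bounded.\<close>
  have "(norm (\<Sum>i<k. h ^ i *\<^sub>R p (a (k - Suc i))))\<^sup>2 \<le> K * h ^ k"
    if h: "0 < h" "h < min \<rho> 1" for h
  proof -
    define t where "t = r + h"
    define g where "g = blinfun_apply (A (of_real t)) u"
    define y where "y = u + (t0 - t) *\<^sub>R g"
    have t: "non_resonant H0 V F lam t"
      using h by (intro non_resonant_punctured) (auto simp: t_def)
    have tD: "complex_of_real t \<in> D"
      using h by (auto simp: t_def dist_norm)
    have coef: "(1 / (complex_of_real t - of_real r) ^ Suc j) *\<^sub>C x = (1 / h ^ Suc j) *\<^sub>R x" for j and x :: 'k
      by (simp add: t_def flip: scaleC_of_real)
    have g: "g = (\<Sum>j<k. (1 / h ^ Suc j) *\<^sub>R n j)"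
      unfolding g_def n_def A_expansion[OF tD u order_refl] coef ..
    have hg: "h ^ k *\<^sub>R g = (\<Sum>j<k. h ^ (k - Suc j) *\<^sub>R n j)"
      unfolding g scaleR_sum_right using h
      by (intro sum.cong) (auto simp: power_diff field_simps)
    have n0: "n 0 = u" and nk: "n k = 0"
      using kernel_N_funpow(2)[OF u order_refl] by (simp_all add: n_def)
    \<comment> \<open>Extending the sum by one index at both ends costs only the first term
      \<open>h ^ k *\<^sub>R u\<close>, because \<open>n k = 0\<close>.\<close>
    have shift: "(\<Sum>j<k. h ^ (k - Suc j) *\<^sub>R n (Suc j)) = h *\<^sub>R (h ^ k *\<^sub>R g) - h ^ k *\<^sub>R u"
    proof -
      have "(\<Sum>j<k. h ^ (k - Suc j) *\<^sub>R n (Suc j)) = (\<Sum>j<Suc k. h ^ (k - j) *\<^sub>R n j) - h ^ k *\<^sub>R u"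
        by (simp only: sum.lessThan_Suc_shift n0 diff_zero add_diff_cancel_left')
      also have "(\<Sum>j<Suc k. h ^ (k - j) *\<^sub>R n j) = (\<Sum>j<k. h *\<^sub>R h ^ (k - Suc j) *\<^sub>R n j)"
        using nk by (auto intro!: sum.cong simp: Suc_diff_Suc simp flip: power_Suc)
      finally show ?thesis by (simp add: hg scaleR_sum_right)
    qed
    have "(\<Sum>j<k. h ^ (k - Suc j) *\<^sub>R a j) = (r - t0) *\<^sub>R (h ^ k *\<^sub>R g) + (h *\<^sub>R (h ^ k *\<^sub>R g) - h ^ k *\<^sub>R u)"
      unfolding a_def scaleR_add_right sum.distrib shift hg scaleR_sum_right
      by (simp add: mult.commute)
    also have "\<dots> = - (h ^ k *\<^sub>R y)"
      by (simp add: y_def t_def algebra_simps)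
    finally have ya: "h ^ k *\<^sub>R y = - (\<Sum>j<k. h ^ (k - Suc j) *\<^sub>R a j)" by simp
    have "(\<Sum>i<k. h ^ i *\<^sub>R p (a (k - Suc i))) = (\<Sum>j<k. h ^ (k - Suc j) *\<^sub>R p (a j))"
      by (rule sum.reindex_bij_witness[of _ "\<lambda>j. k - Suc j" "\<lambda>j. k - Suc j"]) auto
    also have "\<dots> = - (h ^ k *\<^sub>R p y)"
      using arg_cong[OF ya, of p]
      by (simp add: linear_scale[OF p] linear_neg[OF p] linear_sum[OF p])
    finally have "(norm (\<Sum>i<k. h ^ i *\<^sub>R p (a (k - Suc i))))\<^sup>2 = (h ^ k)\<^sup>2 * (norm (p y))\<^sup>2"
      by (simp add: power_mult_distrib)
    also have "\<dots> \<le> (h ^ k)\<^sup>2 * \<bar>Im (cinner (blinfun_apply J u) g)\<bar>"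
      using norm_sqrt_Im_B[OF t0, of "blinfun_apply J y"] form_transformation[OF t t0, of y u]
      by (intro mult_left_mono) (simp_all add: p_def y_def g_def)
    also have "\<dots> \<le> (h ^ k)\<^sup>2 * (norm (blinfun_apply J u) * norm g * 2)"
      by (intro mult_left_mono order_trans[OF abs_Im_le_cmod norm_cinner_le]) simp
    \<comment> \<open>One of the two factors h^k clears the pole of \<open>g\<close>; the other is
      the gain that the coefficient comparison exploits.\<close>
    also have "\<dots> = h ^ k * (2 * norm (blinfun_apply J u) * norm (h ^ k *\<^sub>R g))"
      using h by (simp add: power2_eq_square)
    also have "\<dots> \<le> h ^ k * (2 * norm (blinfun_apply J u) * (\<Sum>j<k. norm (n j)))"
    proof (intro mult_left_mono)
      show "norm (h ^ k *\<^sub>R g) \<le> (\<Sum>j<k. norm (n j))"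
        unfolding hg
      proof (rule order_trans[OF norm_sum sum_mono])
        fix j
        show "norm (h ^ (k - Suc j) *\<^sub>R n j) \<le> norm (n j)"
          using h by (simp add: mult_left_le_one_le power_le_one)
      qed
    qed (use h in auto)
    finally show ?thesis by (simp only: K_def mult.commute)
  qed
  from lower_coefficients_vanish[where e = "min \<rho> 1", OF _ this m]
  have "p (a (k - Suc m)) = 0" using radius by simp
  moreover have "Suc (k - Suc m) = k - m" using m by simp
  ultimately show ?thesis by (simp add: p_def a_def n_def)
qed

text \<open>Induction on \<open>m\<close> starts from \<open>N^k u = 0\<close>. Each vanishing
  combination contains the next vector with the factor r - t0, which is nonzero because
  \<open>r\<close> is resonant and \<open>t0\<close> is not.\<close>

lemma sqrt_Im_vanishes:
  assumes t0: "non_resonant H0 V F lam t0" and u: "(M ^^ k) u = 0"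
  shows "2 * m < k + 2 \<Longrightarrow> m \<le> k \<Longrightarrow>
    blinfun_apply (op_sqrt (op_Im (B lam t0 1))) (blinfun_apply J ((N k ^^ (k - m)) u)) = 0"
proof (induction m)
  case 0
  then show ?case using kernel_N_funpow(2)[OF u order_refl] by (simp add: blinfun.zero_right)
next
  case (Suc m)
  have "r \<noteq> t0" using t0 resonant by blast
  moreover have "blinfun_apply (op_sqrt (op_Im (B lam t0 1))) (blinfun_apply J ((N k ^^ (k - m)) u)) = 0"
    using Suc by simp
  ultimately show ?case
    using sqrt_Im_combination_vanishes[OF t0 u, of m] Suc.prems
    by (simp add: blinfun.add_right blinfun.scaleR_right)
qed

end

theorem theorem1p31:
  fixes H0 V :: "('h::complex_hilbert \<times> 'h) set"
    and F :: "('h \<times> 'k::complex_hilbert) set"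
    and J :: "'k \<Rightarrow>\<^sub>L 'k"
    and A :: "complex \<Rightarrow> 'k \<Rightarrow>\<^sub>L 'k"
    and lam r_lam \<sigma> \<rho> s :: real
    and u :: 'k
    and k :: nat
  assumes "operator_line H0 V F J"
    and "regular_line H0 V F lam"
    and "\<not> non_resonant H0 V F lam r_lam"
    and "\<sigma> \<in> {1, -1}"
    and "meromorphic_continuation H0 V F J lam \<sigma> A"
    and "\<rho> > 0" and "holomorphic_at_each A (cball (of_real r_lam) \<rho> - {of_real r_lam})"
    and "non_resonant H0 V F lam s"
    and "has_order A s r_lam u k"
  shows "\<forall>j\<in>{1..nat \<lceil>real k / 2\<rceil>}. type_I H0 V F J lam A s r_lam
    ((blinfun_apply (resonance_nilpotent A r_lam \<rho>) ^^ (k - j)) u)"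
proof
  interpret resonance H0 V F J A lam r_lam \<sigma> \<rho> s
    using assms(1,3-8) by (intro resonance.intro resonance_axioms.intro)
  fix j assume "j \<in> {1..nat \<lceil>real k / 2\<rceil>}"
  then have "1 \<le> j" "j \<le> nat \<lceil>real k / 2\<rceil>" by simp_all
  \<comment> \<open>The ceiling of k/2 is less than k/2 + 1, which is the range reached by the
    induction; together with \<open>1 \<le> j\<close> it also gives
    \<open>j \<le> k\<close>.\<close>
  moreover from this have "real j < real k / 2 + 1" by linarith
  ultimately have j: "2 * j < k + 2" "j \<le> k" by linarith+
  have space: "resonance_space A s r_lam m = {v. (M ^^ m) v = 0}" for m
    by (simp add: resonance_space_def M_def[abs_def])
  have u: "(M ^^ k) u = 0" using assms(9) by (simp add: has_order_def space)
  show "type_I H0 V F J lam A s r_lam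
      ((blinfun_apply (resonance_nilpotent A r_lam \<rho>) ^^ (k - j)) u)"
    unfolding type_I_def nilpotent_funpow_eq_N[OF u] space
    using kernel_N_funpow(1)[OF u] sqrt_Im_vanishes[OF _ u j] by blast
qed

end
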